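(* Let $(\mathcal G_1,e_1)$, $(\mathcal G_2,e_2)$ be rooted graphs with spectral distributions $\mu_1,\mu_2$, let their free product $\mathcal G_1*\mathcal G_2$ (with root $e$) be naturally colored, and let $A(\mathcal G_1*\mathcal G_2)=S_1+S_2$ be the decomposition of its adjacency matrix induced by the coloring. Put $Z=S_2S_1$. Then for every $n\in\mathbb N$ $$N_Z(n)=N_{\mu_1\boxtimes\mu_2}(n)=|D_{2n}(e)|,$$ where $N_Z(n)$ refers to the state $\varphi_e$ and $D_{2n}(e)$ is the set of rooted alternating d-walks of length $2n$ on $\mathcal G_1*\mathcal G_2$. Moreover, the pair $(S_1-1,S_2-1)$ is free with respect to $\varphi_e$.
   Context: Graphs are non-oriented, connected, uniformly locally finite (bounded degrees), with a root, possibly with loops and multiple edges. The adjacency matrix of $\mathcal G$ is the operator $A(\mathcal G)\delta(x)=\sum_{x'\sim x}n(x,x')\delta(x')$ on $\ell^2(V)$, $n(x,x')$ being the number of edges joining $x,x'$ (a loop at $x$ contributes $1$ to $n(x,x)$). $\varphi_e(\cdot)=\langle\cdot\,\delta(e),\delta(e)\rangle$; the spectral distribution of $(\mathcal G,e)$ is the distribution of $A(\mathcal G)$ in the state $\varphi_e$. Free product $\mathcal G_1*\mathcal G_2$: with $V_\iota^0=V_\iota\setminus\{e_\iota\}$, vertices are the empty word $e$ (the root) and all words $v_1v_2\cdots v_n$, $v_i\in V^0_{\iota_i}$, $\iota_1\ne\iota_2\ne\dots\ne\iota_n$; for each $\iota\in\{1,2\}$ and each word $w$ not beginning with a letter from $V_\iota^0$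 (the empty word included) there is a copy of $\mathcal G_\iota$ on the vertices $\{w\}\cup\{vw:v\in V_\iota^0\}$, with $w$ in the role of $e_\iota$; these are all edges. Natural coloring: edges of each copy of $\mathcal G_\iota$ get color $\iota$. $S_\iota$ is the adjacency matrix of the subgraph of edges of color $\iota$. A walk from $v_0$ to $v_n$ is a sequence $(v_0,\beta_1,v_1,\dots,\beta_n,v_n)$, $\beta_i$ an edge joining $v_{i-1}$ and $v_i$; its length is $n$. An f-walk from $v$ to $v$ is a walk with $v_0=v_n=v$ and $v_i\neq v$ for $1\le i\le n-1$. A walk is alternating if the colors of its successive edges alternate. An alternating d-walk from $v$ to $v$ is an alternating walk beginning with an edge of color $1$ which is the concatenation $(u_1,u_2)$ of two f-walks from $v$ to $v$. Rooted means $v=e$. For a unital functional $\mu$ on $\mathbb C[X]$ ($\mu(1)=1$; compactly supported measures are identified with their moment functionals) put $\psi_\mu(z)=\sum_{n\ge1}\mu(X^n)z^n$, $\eta_\mu=\psi_\mu/(1+\psi_\mu)=\sum_{n\ge1}N_\mu(n)z^n$ (formal power series). For a random variable $Z$ and a state, $N_Z(n)=N_\mu(n)$ with $\mu$ the distribution of $Z$ in that state. $\mu_1\boxtimes\mu_2$ is the free multiplicative convolution: the distribution of the product of two free random variables with distributions $\mu_1$ and $\mu_2$. *)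

theory Defs
  imports "HOL-Analysis.Analysis" "HOL-Library.Poly_Mapping"
begin

section \<open>Complex algebras, distributions and freeness\<close>

class complex_algebra = ring +
  fixes scaleC :: "complex \<Rightarrow> 'a \<Rightarrow> 'a"  (infixr "*\<^sub>C" 75)
  assumes scaleC_add_right: "c *\<^sub>C (x + y) = c *\<^sub>C x + c *\<^sub>C y"
    and scaleC_add_left: "(c + d) *\<^sub>C x = c *\<^sub>C x + d *\<^sub>C x"
    and scaleC_scaleC: "c *\<^sub>C d *\<^sub>C x = (c * d) *\<^sub>C x"
    and scaleC_one: "1 *\<^sub>C x = x"
    and mult_scaleC_left: "(c *\<^sub>C x) * y = c *\<^sub>C (x * y)"
    and mult_scaleC_right: "x * (c *\<^sub>C y) = c *\<^sub>C (x * y)"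

text \<open>
  The unit \<open>u\<close> of the algebra under consideration is always passed explicitly, because the algebra
  of bounded operators on \<open>\<ell>\<^sup>2(V)\<close>, for a set \<open>V\<close> of elements of a type \<open>'v\<close>, appears below as a
  corner of the algebra of bounded operators on \<open>\<ell>\<^sup>2('v)\<close>; its unit is the projection onto \<open>\<ell>\<^sup>2(V)\<close>.
\<close>

primrec unital_power :: "'a::complex_algebra \<Rightarrow> 'a \<Rightarrow> nat \<Rightarrow> 'a" where
  "unital_power u a 0 = u"
| "unital_power u a (Suc n) = a * unital_power u a n"

definition poly_eval :: "'a::complex_algebra \<Rightarrow> complex poly \<Rightarrow> 'a \<Rightarrow> 'a" where
  "poly_eval u p a = (\<Sum>i\<le>degree p. coeff p i *\<^sub>C unital_power u a i)"

text \<open>A (compactly supported) measure is identified with its moment functional on \<open>\<complex>[X]\<close>.\<close>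

type_synonym functional = "complex poly \<Rightarrow> complex"

definition distribution :: "'a::complex_algebra \<Rightarrow> ('a \<Rightarrow> complex) \<Rightarrow> 'a \<Rightarrow> functional" where
  "distribution u \<phi> a = (\<lambda>p. \<phi> (poly_eval u p a))"

definition unital_functional :: "'a::complex_algebra \<Rightarrow> ('a \<Rightarrow> complex) \<Rightarrow> bool" where
  "unital_functional u \<phi> \<longleftrightarrow>
     (\<forall>a b. \<phi> (a + b) = \<phi> a + \<phi> b) \<and> (\<forall>c a. \<phi> (c *\<^sub>C a) = c * \<phi> a) \<and> \<phi> u = 1"

definition free_subalgebras ::
    "'a::complex_algebra \<Rightarrow> ('a \<Rightarrow> complex) \<Rightarrow> ('i \<Rightarrow> 'a set) \<Rightarrow> bool" where
  "free_subalgebras u \<phi> A \<longleftrightarrow>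
     (\<forall>is as. is \<noteq> [] \<and> length as = length is \<and> distinct_adj is \<and>
        (\<forall>j<length is. as ! j \<in> A (is ! j) \<and> \<phi> (as ! j) = 0) \<longrightarrow>
        \<phi> (foldr (*) as u) = 0)"

definition generated_algebra :: "'a::complex_algebra \<Rightarrow> 'a \<Rightarrow> 'a set" where
  "generated_algebra u a = range (\<lambda>p. poly_eval u p a)"

datatype color = Color1 | Color2

definition free_pair :: "'a::complex_algebra \<Rightarrow> ('a \<Rightarrow> complex) \<Rightarrow> 'a \<Rightarrow> 'a \<Rightarrow> bool" where
  "free_pair u \<phi> a1 a2 \<longleftrightarrow>
     free_subalgebras u \<phi> (case_color (generated_algebra u a1) (generated_algebra u a2))"


section \<open>The algebra of noncommutative polynomials and free multiplicative convolution\<close>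

datatype 'x free_monoid = Word "'x list"

instantiation free_monoid :: (type) monoid_add
begin

definition zero_free_monoid :: "'a free_monoid" where
  "0 = Word []"

fun plus_free_monoid :: "'a free_monoid \<Rightarrow> 'a free_monoid \<Rightarrow> 'a free_monoid" where
  "Word xs + Word ys = Word (xs @ ys)"

instance
proof
  fix a b c :: "'a free_monoid"
  show "a + b + c = a + (b + c)" by (cases a; cases b; cases c) simp
  show "0 + a = a" by (cases a) (simp add: zero_free_monoid_def)
  show "a + 0 = a" by (cases a) (simp add: zero_free_monoid_def)
qed

end

instantiation complex :: complex_algebra
begin

definition scaleC_complex :: "complex \<Rightarrow> complex \<Rightarrow> complex" where
  "scaleC_complex c x = c * x"

instance by standard (auto simp: scaleC_complex_def algebra_simps)

end

lemma scaleC_zero_right [simp]: "c *\<^sub>C (0::'a::complex_algebra) = 0"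
  using scaleC_add_right[of c "0::'a" 0] by simp

lemma scaleC_Sum_any:
  fixes g :: "'b \<Rightarrow> 'a::complex_algebra"
  assumes "finite {x. g x \<noteq> 0}"
  shows "c *\<^sub>C Sum_any g = (\<Sum>x. c *\<^sub>C g x)"
proof -
  have sub: "{x. c *\<^sub>C g x \<noteq> 0} \<subseteq> {x. g x \<noteq> 0}" by auto
  have hom: "c *\<^sub>C (\<Sum>x\<in>F. g x) = (\<Sum>x\<in>F. c *\<^sub>C g x)" for F
    by (induction F rule: infinite_finite_induct) (auto simp: scaleC_add_right)
  show ?thesis
    unfolding Sum_any.expand_superset[OF assms sub] by (simp add: Sum_any.expand_set hom)
qed

instantiation poly_mapping :: (monoid_add, complex_algebra) complex_algebra
begin

lift_definition scaleC_poly_mapping :: "complex \<Rightarrow> ('a \<Rightarrow>\<^sub>0 'b) \<Rightarrow> 'a \<Rightarrow>\<^sub>0 'b"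
  is "\<lambda>c f k. c *\<^sub>C f k"
  by (erule finite_subset[rotated]) auto

instance
proof
  fix c d :: complex and x y :: "'a \<Rightarrow>\<^sub>0 'b"
  show "c *\<^sub>C (x + y) = c *\<^sub>C x + c *\<^sub>C y"
    by transfer (simp add: scaleC_add_right)
  show "(c + d) *\<^sub>C x = c *\<^sub>C x + d *\<^sub>C x"
    by transfer (simp add: scaleC_add_left)
  show "c *\<^sub>C d *\<^sub>C x = (c * d) *\<^sub>C x"
    by transfer (simp add: scaleC_scaleC)
  show "1 *\<^sub>C x = x"
    by transfer (simp add: scaleC_one)
  have fin1: "finite {q. (poly_mapping.lookup y q when k = l + q) \<noteq> 0}" for k l :: 'a
    by (rule finite_subset[OF _ Poly_Mapping.finite_lookup[of y]]) auto
  have fin2: "finite {l. poly_mapping.lookup x l * t l \<noteq> 0}" for t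
    by (rule finite_subset[OF _ Poly_Mapping.finite_lookup[of x]]) auto
  have when_scaleC: "(c *\<^sub>C b when P) = c *\<^sub>C (b when P)" for b :: 'b and P
    by (simp add: when_def)
  show "(c *\<^sub>C x) * y = c *\<^sub>C (x * y)"
    by (rule poly_mapping_eqI)
      (simp add: lookup_mult scaleC_poly_mapping.rep_eq mult_scaleC_left scaleC_Sum_any[OF fin2])
  show "x * (c *\<^sub>C y) = c *\<^sub>C (x * y)"
    by (rule poly_mapping_eqI)
      (simp add: lookup_mult scaleC_poly_mapping.rep_eq when_scaleC scaleC_Sum_any[OF fin1, symmetric]
        mult_scaleC_right scaleC_Sum_any[OF fin2])
qed

end

text \<open>The free unital algebra \<open>\<complex>\<langle>X\<^sub>1, X\<^sub>2\<rangle>\<close> on two generators.\<close>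

type_synonym ncpoly = "color free_monoid \<Rightarrow>\<^sub>0 complex"

definition ncvar :: "color \<Rightarrow> ncpoly" where
  "ncvar i = Poly_Mapping.single (Word [i]) 1"

text \<open>
  The joint moments of free variables are determined by the individual distributions, so there is
  exactly one functional on \<open>\<complex>\<langle>X\<^sub>1, X\<^sub>2\<rangle>\<close> for which \<open>X\<^sub>1, X\<^sub>2\<close> are free with distributions
  \<open>\<mu>\<^sub>1, \<mu>\<^sub>2\<close>; under it \<open>X\<^sub>1 X\<^sub>2\<close> is a product of two free variables with these distributions.
\<close>

definition free_product_functional :: "functional \<Rightarrow> functional \<Rightarrow> ncpoly \<Rightarrow> complex" where
  "free_product_functional \<mu>1 \<mu>2 =
     (THE \<phi>. unital_functional 1 \<phi> \<and> free_pair 1 \<phi> (ncvar Color1) (ncvar Color2) \<and>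
        distribution 1 \<phi> (ncvar Color1) = \<mu>1 \<and> distribution 1 \<phi> (ncvar Color2) = \<mu>2)"

definition free_mult_conv :: "functional \<Rightarrow> functional \<Rightarrow> functional"  (infixl "\<boxtimes>" 70) where
  "\<mu>1 \<boxtimes> \<mu>2 =
     distribution 1 (free_product_functional \<mu>1 \<mu>2) (ncvar Color1 * ncvar Color2)"

definition psi_series :: "functional \<Rightarrow> complex fps" where
  "psi_series \<mu> = Abs_fps (\<lambda>n. if n = 0 then 0 else \<mu> (monom 1 n))"

definition eta_series :: "functional \<Rightarrow> complex fps" where
  "eta_series \<mu> = psi_series \<mu> / (1 + psi_series \<mu>)"

definition eta_coeff :: "functional \<Rightarrow> nat \<Rightarrow> complex" where
  "eta_coeff \<mu> n = fps_nth (eta_series \<mu>) n"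


section \<open>Square-summable functions and bounded operators\<close>

typedef 'v ell2 = "{f :: 'v \<Rightarrow> complex. (\<lambda>x. (cmod (f x))\<^sup>2) summable_on UNIV}"
  morphisms coord Abs_ell2
  by (rule exI[of _ "\<lambda>_. 0"]) simp

setup_lifting type_definition_ell2

lemma ell2_finite_bound:
  assumes "\<And>F. finite F \<Longrightarrow> L2_set (\<lambda>x. cmod (f x)) F \<le> B"
  shows "(\<lambda>x. (cmod (f x))\<^sup>2) summable_on UNIV"
    and "sqrt (\<Sum>\<^sub>\<infinity>x. (cmod (f x))\<^sup>2) \<le> B"
proof -
  have B: "0 \<le> B" using assms[of "{}"] by simp
  have le: "(\<Sum>x\<in>F. (cmod (f x))\<^sup>2) \<le> B\<^sup>2" if "finite F" for F
    using assms[OF that] unfolding L2_set_def by (rule sqrt_le_D)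
  show *: "(\<lambda>x. (cmod (f x))\<^sup>2) summable_on UNIV"
    by (rule nonneg_bdd_above_summable_on) (auto intro!: bdd_aboveI2[where M="B\<^sup>2"] le)
  have "(\<Sum>\<^sub>\<infinity>x. (cmod (f x))\<^sup>2) \<le> B\<^sup>2"
    by (rule infsum_le_finite_sums[OF *]) (auto intro: le)
  then show "sqrt (\<Sum>\<^sub>\<infinity>x. (cmod (f x))\<^sup>2) \<le> B"
    using B by (rule real_le_lsqrt[rotated])
qed

lemma ell2_L2_set_le:
  assumes "(\<lambda>x. (cmod (f x))\<^sup>2) summable_on UNIV" "finite F"
  shows "L2_set (\<lambda>x. cmod (f x)) F \<le> sqrt (\<Sum>\<^sub>\<infinity>x. (cmod (f x))\<^sup>2)"
  unfolding L2_set_def using assms by (auto intro: finite_sum_le_infsum)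

lemma ell2_add_L2_set:
  assumes "(\<lambda>x. (cmod (f x))\<^sup>2) summable_on UNIV" "(\<lambda>x. (cmod (g x))\<^sup>2) summable_on UNIV"
    and "finite F"
  shows "L2_set (\<lambda>x. cmod (f x + g x)) F
           \<le> sqrt (\<Sum>\<^sub>\<infinity>x. (cmod (f x))\<^sup>2) + sqrt (\<Sum>\<^sub>\<infinity>x. (cmod (g x))\<^sup>2)"
proof -
  have "L2_set (\<lambda>x. cmod (f x + g x)) F \<le> L2_set (\<lambda>x. cmod (f x) + cmod (g x)) F"
    by (rule L2_set_mono) (auto intro: norm_triangle_ineq)
  also have "\<dots> \<le> L2_set (\<lambda>x. cmod (f x)) F + L2_set (\<lambda>x. cmod (g x)) F"
    by (rule L2_set_triangle_ineq)
  finally show ?thesis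
    using ell2_L2_set_le[OF assms(1,3)] ell2_L2_set_le[OF assms(2,3)] by linarith
qed

lemma ell2_cmult:
  assumes "(\<lambda>x. (cmod (f x))\<^sup>2) summable_on UNIV"
  shows "(\<lambda>x. (cmod (c * f x))\<^sup>2) summable_on UNIV"
  using summable_on_cmult_right[OF assms, of "(cmod c)\<^sup>2"] by (simp add: norm_mult power_mult_distrib)

instantiation ell2 :: (type) real_vector
begin

lift_definition zero_ell2 :: "'a ell2" is "\<lambda>_. 0" by simp
lift_definition plus_ell2 :: "'a ell2 \<Rightarrow> 'a ell2 \<Rightarrow> 'a ell2" is "\<lambda>f g x. f x + g x"
  by (rule ell2_finite_bound(1)[OF ell2_add_L2_set])
lift_definition uminus_ell2 :: "'a ell2 \<Rightarrow> 'a ell2" is "\<lambda>f x. - f x" by simp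
lift_definition minus_ell2 :: "'a ell2 \<Rightarrow> 'a ell2 \<Rightarrow> 'a ell2" is "\<lambda>f g x. f x - g x"
proof -
  fix f g :: "'a \<Rightarrow> complex"
  assume "(\<lambda>x. (cmod (f x))\<^sup>2) summable_on UNIV" "(\<lambda>x. (cmod (g x))\<^sup>2) summable_on UNIV"
  then show "(\<lambda>x. (cmod (f x - g x))\<^sup>2) summable_on UNIV"
    using ell2_finite_bound(1)[OF ell2_add_L2_set[of f "\<lambda>x. - g x"]] by simp
qed
lift_definition scaleR_ell2 :: "real \<Rightarrow> 'a ell2 \<Rightarrow> 'a ell2" is "\<lambda>r f x. of_real r * f x"
  by (rule ell2_cmult)

instance
proof
  fix f g h :: "'a ell2" and r s :: real
  show "f + g + h = f + (g + h)" by transfer (simp add: add.assoc)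
  show "f + g = g + f" by transfer (simp add: add.commute)
  show "0 + f = f" by transfer simp
  show "- f + f = 0" by transfer simp
  show "f - g = f + - g" by transfer simp
  show "r *\<^sub>R (f + g) = r *\<^sub>R f + r *\<^sub>R g" by transfer (simp add: algebra_simps)
  show "(r + s) *\<^sub>R f = r *\<^sub>R f + s *\<^sub>R f" by transfer (simp add: algebra_simps)
  show "r *\<^sub>R s *\<^sub>R f = (r * s) *\<^sub>R f" by transfer (simp add: algebra_simps)
  show "1 *\<^sub>R f = f" by transfer simp
qed

end

instantiation ell2 :: (type) real_normed_vector
begin

lift_definition norm_ell2 :: "'a ell2 \<Rightarrow> real" is "\<lambda>f. sqrt (\<Sum>\<^sub>\<infinity>x. (cmod (f x))\<^sup>2)" .

definition dist_ell2 :: "'a ell2 \<Rightarrow> 'a ell2 \<Rightarrow> real" where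
  "dist_ell2 f g = norm (f - g)"
definition sgn_ell2 :: "'a ell2 \<Rightarrow> 'a ell2" where
  "sgn_ell2 f = f /\<^sub>R norm f"
definition uniformity_ell2 :: "('a ell2 \<times> 'a ell2) filter" where
  "uniformity_ell2 = (INF e\<in>{0<..}. principal {(f, g). dist f g < e})"
definition open_ell2 :: "'a ell2 set \<Rightarrow> bool" where
  "open_ell2 U \<longleftrightarrow> (\<forall>f\<in>U. \<forall>\<^sub>F (f', g) in uniformity. f' = f \<longrightarrow> g \<in> U)"

instance
proof
  fix f g :: "'a ell2" and r :: real
  show "dist f g = norm (f - g)" by (rule dist_ell2_def)
  show "sgn f = f /\<^sub>R norm f" by (rule sgn_ell2_def)
  show "(uniformity :: ('a ell2 \<times> 'a ell2) filter) = (INF e\<in>{0<..}. principal {(f, g). dist f g < e})"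
    by (rule uniformity_ell2_def)
  show "open U \<longleftrightarrow> (\<forall>f\<in>U. \<forall>\<^sub>F (f', g) in uniformity. f' = f \<longrightarrow> g \<in> U)" for U :: "'a ell2 set"
    by (rule open_ell2_def)
  show "norm f = 0 \<longleftrightarrow> f = 0"
  proof transfer
    fix f :: "'a \<Rightarrow> complex"
    assume f: "(\<lambda>x. (cmod (f x))\<^sup>2) summable_on UNIV"
    show "sqrt (\<Sum>\<^sub>\<infinity>x. (cmod (f x))\<^sup>2) = 0 \<longleftrightarrow> f = (\<lambda>_. 0)"
    proof
      assume "sqrt (\<Sum>\<^sub>\<infinity>x. (cmod (f x))\<^sup>2) = 0"
      then have "(\<Sum>\<^sub>\<infinity>x. (cmod (f x))\<^sup>2) \<le> 0" by simp
      then have "(cmod (f x))\<^sup>2 = 0" for x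
        by (rule nonneg_infsum_le_0D[OF _ f]) auto
      then show "f = (\<lambda>_. 0)" by (simp add: fun_eq_iff)
    qed simp
  qed
  show "norm (f + g) \<le> norm f + norm g"
    by transfer (rule ell2_finite_bound(2)[OF ell2_add_L2_set])
  show "norm (r *\<^sub>R f) = \<bar>r\<bar> * norm f"
    by transfer
      (simp add: norm_mult power_mult_distrib infsum_cmult_right' real_sqrt_mult)
qed

end

lift_definition cscale :: "complex \<Rightarrow> 'v ell2 \<Rightarrow> 'v ell2" is "\<lambda>c f x. c * f x"
  by (rule ell2_cmult)

lift_definition delta :: "'v \<Rightarrow> 'v ell2" is "\<lambda>v x. if x = v then 1 else 0"
  subgoal for v
    by (rule summable_on_cong_neutral[where T="{v}", THEN iffD2]) auto
  done

lift_definition inner_ell2 :: "'v ell2 \<Rightarrow> 'v ell2 \<Rightarrow> complex"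
  is "\<lambda>f g. \<Sum>\<^sub>\<infinity>x. f x * cnj (g x)" .

typedef 'v bop =
  "{T :: 'v ell2 \<Rightarrow> 'v ell2. bounded_linear T \<and> (\<forall>c f. T (cscale c f) = cscale c (T f))}"
  morphisms bop_apply Abs_bop
  by (rule exI[of _ "\<lambda>_. 0"]) (auto intro: bounded_linear_zero, transfer, simp)

setup_lifting type_definition_bop

lemma cscale_add: "cscale c (f + g) = cscale c f + cscale c g"
  by transfer (simp add: algebra_simps)

lemma cscale_minus: "cscale c (f - g) = cscale c f - cscale c g"
  by transfer (simp add: algebra_simps)

lemma cscale_uminus: "cscale c (- f) = - cscale c f"
  by transfer simp

lemma cscale_zero: "cscale c 0 = 0"
  by transfer simp

lemma cscale_add_left: "cscale (c + d) f = cscale c f + cscale d f"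
  by transfer (simp add: algebra_simps)

lemma cscale_cscale: "cscale c (cscale d f) = cscale (c * d) f"
  by transfer (simp add: algebra_simps)

lemma cscale_one: "cscale 1 f = f"
  by transfer simp

lemma bounded_linear_cscale: "bounded_linear (cscale c)"
proof (rule bounded_linear_intro)
  show "cscale c (f + g) = cscale c f + cscale c g" for f g :: "'a ell2" by (rule cscale_add)
  show "cscale c (r *\<^sub>R f) = r *\<^sub>R cscale c f" for r and f :: "'a ell2"
    by transfer (simp add: algebra_simps)
  show "norm (cscale c f) \<le> norm f * cmod c" for f :: "'a ell2"
    by transfer
      (simp add: norm_mult power_mult_distrib infsum_cmult_right' real_sqrt_mult mult.commute)
qed

instantiation bop :: (type) complex_algebra
begin

lift_definition zero_bop :: "'a bop" is "\<lambda>_. 0"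
  by (simp add: cscale_zero)
lift_definition plus_bop :: "'a bop \<Rightarrow> 'a bop \<Rightarrow> 'a bop" is "\<lambda>S T f. S f + T f"
  by (auto intro: bounded_linear_add simp: cscale_add)
lift_definition uminus_bop :: "'a bop \<Rightarrow> 'a bop" is "\<lambda>T f. - T f"
  by (auto intro: bounded_linear_minus simp: cscale_uminus)
lift_definition minus_bop :: "'a bop \<Rightarrow> 'a bop \<Rightarrow> 'a bop" is "\<lambda>S T f. S f - T f"
  by (auto intro: bounded_linear_sub simp: cscale_minus)
lift_definition times_bop :: "'a bop \<Rightarrow> 'a bop \<Rightarrow> 'a bop" is "\<lambda>S T f. S (T f)"
  by (auto intro: bounded_linear_compose)
lift_definition scaleC_bop :: "complex \<Rightarrow> 'a bop \<Rightarrow> 'a bop" is "\<lambda>c T f. cscale c (T f)"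
  by (auto intro: bounded_linear_compose[OF bounded_linear_cscale]
      simp: cscale_cscale mult.commute)

instance
proof
  fix R S T :: "'a bop" and c d :: complex
  show "R + S + T = R + (S + T)" by transfer (simp add: add.assoc)
  show "R + S = S + R" by transfer (simp add: add.commute)
  show "0 + R = R" by transfer simp
  show "- R + R = 0" by transfer simp
  show "R - S = R + - S" by transfer simp
  show "R * S * T = R * (S * T)" by transfer simp
  show "(R + S) * T = R * T + S * T" by transfer simp
  show "R * (S + T) = R * S + R * T"
    by transfer (auto simp: bounded_linear.linear linear_add)
  show "c *\<^sub>C (R + S) = c *\<^sub>C R + c *\<^sub>C S" by transfer (simp add: cscale_add)
  show "(c + d) *\<^sub>C R = c *\<^sub>C R + d *\<^sub>C R" by transfer (simp add: cscale_add_left)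
  show "c *\<^sub>C d *\<^sub>C R = (c * d) *\<^sub>C R" by transfer (simp add: cscale_cscale)
  show "1 *\<^sub>C R = R" by transfer (simp add: cscale_one)
  show "(c *\<^sub>C R) * S = c *\<^sub>C (R * S)" by transfer simp
  show "R * (c *\<^sub>C S) = c *\<^sub>C (R * S)" by transfer simp
qed

end

text \<open>The projection onto \<open>\<ell>\<^sup>2(V)\<close>, i.e. the unit of the algebra of bounded operators on \<open>\<ell>\<^sup>2(V)\<close>.\<close>

lift_definition restrict_ell2 :: "'v set \<Rightarrow> 'v ell2 \<Rightarrow> 'v ell2"
  is "\<lambda>V f x. if x \<in> V then f x else 0"
  by (rule summable_on_comparison_test) auto

lift_definition unit_op :: "'v set \<Rightarrow> 'v bop" is restrict_ell2
proof (intro conjI allI)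
  fix V :: "'v set"
  show "bounded_linear (restrict_ell2 V)"
  proof (rule bounded_linear_intro)
    show "restrict_ell2 V (f + g) = restrict_ell2 V f + restrict_ell2 V g" for f g :: "'v ell2"
      by transfer auto
    show "restrict_ell2 V (r *\<^sub>R f) = r *\<^sub>R restrict_ell2 V f" for r and f :: "'v ell2"
      by transfer auto
    show "norm (restrict_ell2 V f) \<le> norm f * 1" for f :: "'v ell2"
    proof transfer
      fix V :: "'v set" and f :: "'v \<Rightarrow> complex"
      assume f: "(\<lambda>x. (cmod (f x))\<^sup>2) summable_on UNIV"
      show "sqrt (\<Sum>\<^sub>\<infinity>x. (cmod (if x \<in> V then f x else 0))\<^sup>2) \<le> sqrt (\<Sum>\<^sub>\<infinity>x. (cmod (f x))\<^sup>2) * 1"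
      proof (rule ell2_finite_bound(2))
        fix F :: "'v set" assume "finite F"
        have "L2_set (\<lambda>x. cmod (if x \<in> V then f x else 0)) F \<le> L2_set (\<lambda>x. cmod (f x)) F"
          by (rule L2_set_mono) auto
        then show "L2_set (\<lambda>x. cmod (if x \<in> V then f x else 0)) F \<le> sqrt (\<Sum>\<^sub>\<infinity>x. (cmod (f x))\<^sup>2) * 1"
          using ell2_L2_set_le[OF f \<open>finite F\<close>] by simp
      qed
    qed
  qed
  show "restrict_ell2 V (cscale c f) = cscale c (restrict_ell2 V f)" for c f
    by transfer auto
qed

definition vector_state :: "'v \<Rightarrow> 'v bop \<Rightarrow> complex" where
  "vector_state e T = inner_ell2 (bop_apply T (delta e)) (delta e)"


section \<open>Rooted graphs and their spectral distributions\<close>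

text \<open>
  Non-oriented graphs with loops and multiple edges: an edge \<open>\<beta>\<close> joins \<open>x\<close> and \<open>x'\<close> iff its set of
  endpoints is \<open>{x, x'}\<close>; in particular, it is a loop at \<open>x\<close> iff that set is \<open>{x}\<close>.
\<close>

record ('v, 'e) rgraph =
  verts :: "'v set"
  edges :: "'e set"
  ends :: "'e \<Rightarrow> 'v set"
  root_vertex :: 'v

definition multigraph :: "('v, 'e) rgraph \<Rightarrow> bool" where
  "multigraph G \<longleftrightarrow> (\<forall>\<beta>\<in>edges G. \<exists>x\<in>verts G. \<exists>x'\<in>verts G. ends G \<beta> = {x, x'})"

definition bounded_degrees :: "('v, 'e) rgraph \<Rightarrow> bool" where
  "bounded_degrees G \<longleftrightarrow>
     (\<exists>K. \<forall>x\<in>verts G. finite {\<beta> \<in> edges G. x \<in> ends G \<beta>} \<and> card {\<beta> \<in> edges G. x \<in> ends G \<beta>} \<le> K)"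

text \<open>The walk \<open>(v\<^sub>0, \<beta>\<^sub>1, v\<^sub>1, \<dots>, \<beta>\<^sub>n, v\<^sub>n)\<close> is the pair \<open>([v\<^sub>0, \<dots>, v\<^sub>n], [\<beta>\<^sub>1, \<dots>, \<beta>\<^sub>n])\<close>.\<close>

type_synonym ('v, 'e) walk = "'v list \<times> 'e list"

fun is_walk :: "('v, 'e) rgraph \<Rightarrow> ('v, 'e) walk \<Rightarrow> bool" where
  "is_walk G (vs, es) \<longleftrightarrow>
     length vs = Suc (length es) \<and> set vs \<subseteq> verts G \<and>
     (\<forall>i<length es. es ! i \<in> edges G \<and> ends G (es ! i) = {vs ! i, vs ! Suc i})"

definition connected_graph :: "('v, 'e) rgraph \<Rightarrow> bool" where
  "connected_graph G \<longleftrightarrow>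
     (\<forall>x\<in>verts G. \<forall>y\<in>verts G. \<exists>vs es. is_walk G (vs, es) \<and> hd vs = x \<and> last vs = y)"

definition rooted_graph :: "('v, 'e) rgraph \<Rightarrow> bool" where
  "rooted_graph G \<longleftrightarrow>
     multigraph G \<and> root_vertex G \<in> verts G \<and> connected_graph G \<and> bounded_degrees G"

definition joining :: "('v, 'e) rgraph \<Rightarrow> 'v \<Rightarrow> 'v \<Rightarrow> 'e set" where
  "joining G x x' = {\<beta> \<in> edges G. ends G \<beta> = {x, x'}}"

definition neighbours :: "('v, 'e) rgraph \<Rightarrow> 'v \<Rightarrow> 'v set" where
  "neighbours G x = {x'. joining G x x' \<noteq> {}}"

text \<open>
  By symmetry of \<open>n(x, x') = card (joining G x x')\<close>, the operator given coordinatewise by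
  \<open>(A f)(x) = \<Sum>x'\<sim>x. n(x, x') f(x')\<close> is the one with \<open>A \<delta>(x) = \<Sum>x'\<sim>x. n(x, x') \<delta>(x')\<close>; see
  \<open>adjacency_delta\<close> below. It is zero on the orthogonal complement of \<open>\<ell>\<^sup>2(verts G)\<close>.
\<close>

definition adjacency :: "('v, 'e) rgraph \<Rightarrow> 'v bop" where
  "adjacency G =
     Abs_bop (\<lambda>f. Abs_ell2 (\<lambda>x. \<Sum>x'\<in>neighbours G x. of_nat (card (joining G x x')) * coord f x'))"

definition spectral_distribution :: "('v, 'e) rgraph \<Rightarrow> functional" where
  "spectral_distribution G =
     distribution (unit_op (verts G)) (vector_state (root_vertex G)) (adjacency G)"

definition color_subgraph :: "('v, 'e) rgraph \<Rightarrow> ('e \<Rightarrow> color) \<Rightarrow> color \<Rightarrow> ('v, 'e) rgraph" where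
  "color_subgraph G c i = G\<lparr>edges := {\<beta> \<in> edges G. c \<beta> = i}\<rparr>"


section \<open>Walks\<close>

text \<open>A walk returning to \<open>v\<close> for the first time at its end has at least one edge.\<close>

fun is_f_walk :: "('v, 'e) rgraph \<Rightarrow> 'v \<Rightarrow> ('v, 'e) walk \<Rightarrow> bool" where
  "is_f_walk G v (vs, es) \<longleftrightarrow>
     is_walk G (vs, es) \<and> es \<noteq> [] \<and> hd vs = v \<and> last vs = v \<and>
     (\<forall>i. 1 \<le> i \<and> i < length es \<longrightarrow> vs ! i \<noteq> v)"

fun concat_walk :: "('v, 'e) walk \<Rightarrow> ('v, 'e) walk \<Rightarrow> ('v, 'e) walk" where
  "concat_walk (vs, es) (vs', es') = (vs @ tl vs', es @ es')"

definition alternating_d_walks ::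
    "('v, 'e) rgraph \<Rightarrow> ('e \<Rightarrow> color) \<Rightarrow> 'v \<Rightarrow> nat \<Rightarrow> ('v, 'e) walk set" where
  "alternating_d_walks G c v m =
     {(vs, es). is_walk G (vs, es) \<and> length es = m \<and> distinct_adj (map c es) \<and>
        es \<noteq> [] \<and> c (hd es) = Color1 \<and>
        (\<exists>u1 u2. is_f_walk G v u1 \<and> is_f_walk G v u2 \<and> (vs, es) = concat_walk u1 u2)}"


section \<open>The free product of rooted graphs\<close>

type_synonym ('v, 'w) word = "('v + 'w) list"

fun letter_color :: "'v + 'w \<Rightarrow> color" where
  "letter_color (Inl _) = Color1"
| "letter_color (Inr _) = Color2"

definition fp_verts :: "('v, 'e) rgraph \<Rightarrow> ('w, 'd) rgraph \<Rightarrow> ('v, 'w) word set" where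
  "fp_verts G1 G2 =
     {w. distinct_adj (map letter_color w) \<and>
         set w \<subseteq> Inl ` (verts G1 - {root_vertex G1}) \<union> Inr ` (verts G2 - {root_vertex G2})}"

text \<open>
  The vertex of the copy attached at \<open>w\<close> which corresponds to \<open>v\<close>; \<open>e\<close> is the root of the copied
  graph, and \<open>emb\<close> is \<open>Inl\<close> or \<open>Inr\<close>.
\<close>

definition attach :: "('x \<Rightarrow> 'v + 'w) \<Rightarrow> 'x \<Rightarrow> ('v, 'w) word \<Rightarrow> 'x \<Rightarrow> ('v, 'w) word" where
  "attach emb e w v = (if v = e then w else emb v # w)"

text \<open>
  The edge \<open>(w, Inl \<beta>)\<close> (or \<open>(w, Inr \<beta>)\<close>) is the one corresponding to \<open>\<beta>\<close> in the copy of the first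
  (or second) graph attached at \<open>w\<close>.
\<close>

definition free_product ::
    "('v, 'e) rgraph \<Rightarrow> ('w, 'd) rgraph \<Rightarrow> (('v, 'w) word, ('v, 'w) word \<times> ('e + 'd)) rgraph" where
  "free_product G1 G2 =
     \<lparr>verts = fp_verts G1 G2,
      edges =
        {(w, Inl \<beta>) |w \<beta>. w \<in> fp_verts G1 G2 \<and> (w \<noteq> [] \<longrightarrow> letter_color (hd w) \<noteq> Color1) \<and> \<beta> \<in> edges G1} \<union>
        {(w, Inr \<beta>) |w \<beta>. w \<in> fp_verts G1 G2 \<and> (w \<noteq> [] \<longrightarrow> letter_color (hd w) \<noteq> Color2) \<and> \<beta> \<in> edges G2},
      ends = (\<lambda>(w, b). case b of
          Inl \<beta> \<Rightarrow> attach Inl (root_vertex G1) w ` ends G1 \<beta>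
        | Inr \<beta> \<Rightarrow> attach Inr (root_vertex G2) w ` ends G2 \<beta>),
      root_vertex = []\<rparr>"

fun natural_color :: "('v, 'w) word \<times> ('e + 'd) \<Rightarrow> color" where
  "natural_color (_, Inl _) = Color1"
| "natural_color (_, Inr _) = Color2"


section \<open>The adjacency operator is well defined\<close>

lemma neighbours_bounded:
  assumes "multigraph G" "bounded_degrees G"
  shows "\<exists>K. \<forall>x x'. finite (neighbours G x) \<and> card (neighbours G x) \<le> K \<and>
    finite (joining G x x') \<and> card (joining G x x') \<le> K"
proof -
  obtain K where K: "\<And>x. x \<in> verts G \<Longrightarrow> finite {\<beta> \<in> edges G. x \<in> ends G \<beta>}"
      "\<And>x. x \<in> verts G \<Longrightarrow> card {\<beta> \<in> edges G. x \<in> ends G \<beta>} \<le> K"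
    using assms(2) unfolding bounded_degrees_def by blast
  have "finite {\<beta> \<in> edges G. x \<in> ends G \<beta>} \<and> card {\<beta> \<in> edges G. x \<in> ends G \<beta>} \<le> K" for x
  proof (cases "x \<in> verts G")
    case False
    then have "{\<beta> \<in> edges G. x \<in> ends G \<beta>} = {}"
      using assms(1) by (auto simp: multigraph_def)
    then show ?thesis by (simp only: finite.emptyI card.empty le0 simp_thms)
  qed (simp add: K)
  then have fin: "finite {\<beta> \<in> edges G. x \<in> ends G \<beta>}"
    and le: "card {\<beta> \<in> edges G. x \<in> ends G \<beta>} \<le> K" for x by auto
  have sub: "joining G x x' \<subseteq> {\<beta> \<in> edges G. x \<in> ends G \<beta>}" for x x'
    by (auto simp: joining_def)
  have img: "neighbours G x \<subseteq>
      (\<lambda>\<beta>. THE x'. ends G \<beta> = {x, x'}) ` {\<beta> \<in> edges G. x \<in> ends G \<beta>}" for x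
  proof
    fix x' assume "x' \<in> neighbours G x"
    then obtain \<beta> where \<beta>: "\<beta> \<in> edges G" "ends G \<beta> = {x, x'}"
      by (auto simp: neighbours_def joining_def)
    moreover have "(THE x'. ends G \<beta> = {x, x'}) = x'"
      using \<beta>(2) by (auto simp: doubleton_eq_iff)
    ultimately show "x' \<in> (\<lambda>\<beta>. THE x'. ends G \<beta> = {x, x'}) ` {\<beta> \<in> edges G. x \<in> ends G \<beta>}"
      by (intro image_eqI[of _ _ \<beta>]) auto
  qed
  show ?thesis
  proof (intro exI[of _ K] allI conjI)
    fix x x'
    show "finite (neighbours G x)" by (rule finite_subset[OF img]) (simp add: fin)
    show "card (neighbours G x) \<le> K"
      by (rule le_trans[OF card_mono[OF finite_imageI[OF fin] img] le_trans[OF card_image_le[OF fin] le]])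
    show "finite (joining G x x')" by (rule finite_subset[OF sub fin])
    show "card (joining G x x') \<le> K" using card_mono[OF fin sub] le le_trans by blast
  qed
qed

lemma neighbours_sym: "x' \<in> neighbours G x \<longleftrightarrow> x \<in> neighbours G x'"
  by (simp add: neighbours_def joining_def insert_commute)

lemma adjacency_finite_bound:
  fixes f :: "'v ell2"
  assumes "multigraph G" "bounded_degrees G"
  shows "\<exists>C. \<forall>(f :: 'v ell2) F. finite F \<longrightarrow>
    L2_set (\<lambda>x. cmod (\<Sum>x'\<in>neighbours G x. of_nat (card (joining G x x')) * coord f x')) F \<le> norm f * C"
proof -
  obtain K where K: "\<And>x. finite (neighbours G x)" "\<And>x. card (neighbours G x) \<le> K"
    "\<And>x x'. finite (joining G x x')" "\<And>x x'. card (joining G x x') \<le> K"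
    using neighbours_bounded[OF assms] by blast
  show ?thesis
  proof (intro exI[of _ "(real K)\<^sup>2"] allI impI)
    fix f :: "'v ell2" and F :: "'v set" assume F: "finite F"
    define a where "a x = cmod (coord f x)" for x
    let ?N = "neighbours G"
    let ?g = "\<lambda>x. cmod (\<Sum>x'\<in>?N x. of_nat (card (joining G x x')) * coord f x')"
    have sq: "(?g x)\<^sup>2 \<le> (real K)^3 * (\<Sum>x'\<in>?N x. (a x')\<^sup>2)" for x
    proof -
      have "?g x \<le> (\<Sum>x'\<in>?N x. cmod (of_nat (card (joining G x x')) * coord f x'))"
        by (rule norm_sum)
      also have "\<dots> \<le> (\<Sum>x'\<in>?N x. real K * a x')"
        by (rule sum_mono) (auto simp: a_def norm_mult K intro!: mult_right_mono)
      finally have "?g x \<le> real K * (\<Sum>x'\<in>?N x. a x')" by (simp add: sum_distrib_left)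
      then have "(?g x)\<^sup>2 \<le> (real K * (\<Sum>x'\<in>?N x. a x'))\<^sup>2"
        by (rule power_mono) simp
      also have "\<dots> = (real K)\<^sup>2 * (\<Sum>x'\<in>?N x. a x')\<^sup>2" by (simp add: power_mult_distrib)
      also have "\<dots> \<le> (real K)\<^sup>2 * (real (card (?N x)) * (\<Sum>x'\<in>?N x. (a x')\<^sup>2))"
        using sum_squared_le_sum_of_squares[of a "?N x"]
        by (intro mult_left_mono) (auto simp: mult.commute)
      also have "\<dots> \<le> (real K)\<^sup>2 * (real K * (\<Sum>x'\<in>?N x. (a x')\<^sup>2))"
        using K(2) by (intro mult_left_mono mult_right_mono) (auto intro: sum_nonneg)
      finally show ?thesis by (simp add: power2_eq_square power3_eq_cube mult.assoc)
    qed
    let ?U = "\<Union>x\<in>F. ?N x"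
    have finU: "finite ?U" using F K(1) by auto
    have "(\<Sum>x\<in>F. \<Sum>x'\<in>?N x. (a x')\<^sup>2) = (\<Sum>x\<in>F. \<Sum>x'\<in>?U. if x' \<in> ?N x then (a x')\<^sup>2 else 0)"
      by (rule sum.cong[OF refl], subst sum.inter_restrict[symmetric, OF finU])
        (auto intro!: sum.cong)
    also have "\<dots> = (\<Sum>x'\<in>?U. \<Sum>x\<in>F. if x \<in> ?N x' then (a x')\<^sup>2 else 0)"
      by (subst sum.swap) (simp add: neighbours_sym[of _ G])
    also have "\<dots> = (\<Sum>x'\<in>?U. real (card (F \<inter> ?N x')) * (a x')\<^sup>2)"
      using F by (simp add: sum.inter_restrict[symmetric])
    also have "\<dots> \<le> (\<Sum>x'\<in>?U. real K * (a x')\<^sup>2)"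
    proof (intro sum_mono mult_right_mono)
      fix x'
      have "card (F \<inter> ?N x') \<le> card (?N x')" by (rule card_mono) (auto simp: K)
      then show "real (card (F \<inter> ?N x')) \<le> real K" using K(2)[of x'] by linarith
    qed simp
    also have "\<dots> = real K * (\<Sum>x'\<in>?U. (a x')\<^sup>2)" by (simp add: sum_distrib_left)
    also have "\<dots> \<le> real K * (norm f)\<^sup>2"
    proof (rule mult_left_mono)
      have "L2_set a ?U \<le> norm f"
        unfolding a_def using ell2_L2_set_le[OF _ finU, of "coord f"] coord[of f]
        by (simp add: norm_ell2.rep_eq)
      then have "(L2_set a ?U)\<^sup>2 \<le> (norm f)\<^sup>2" by (rule power_mono) simp
      then show "(\<Sum>x'\<in>?U. (a x')\<^sup>2) \<le> (norm f)\<^sup>2" by (simp add: L2_set_def sum_nonneg)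
    qed simp
    finally have fin: "(\<Sum>x\<in>F. \<Sum>x'\<in>?N x. (a x')\<^sup>2) \<le> real K * (norm f)\<^sup>2" .
    have "(\<Sum>x\<in>F. (?g x)\<^sup>2) \<le> (\<Sum>x\<in>F. (real K)^3 * (\<Sum>x'\<in>?N x. (a x')\<^sup>2))"
      by (rule sum_mono) (rule sq)
    also have "\<dots> \<le> (real K)^3 * (real K * (norm f)\<^sup>2)"
      using fin by (simp add: sum_distrib_left[symmetric] mult_left_mono)
    also have "\<dots> = (norm f * (real K)\<^sup>2)\<^sup>2"
      by (simp add: power2_eq_square power3_eq_cube algebra_simps)
    finally show "L2_set ?g F \<le> norm f * (real K)\<^sup>2"
      unfolding L2_set_def by (rule real_le_lsqrt[rotated]) (auto intro: sum_nonneg)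
  qed
qed

lemma coord_plus: "coord (f + g) x = coord f x + coord g x"
  by transfer simp

lemma coord_cscale: "coord (cscale c f) x = c * coord f x"
  by transfer simp

lemma ell2_eqI: "(\<And>x. coord f x = coord g x) \<Longrightarrow> f = g"
  by (rule iffD1[OF coord_inject], rule ext)

lemma coord_adjacency:
  assumes "multigraph G" "bounded_degrees G"
  shows "coord (bop_apply (adjacency G) f) x =
           (\<Sum>x'\<in>neighbours G x. of_nat (card (joining G x x')) * coord f x')"
proof -
  let ?g = "\<lambda>f x. \<Sum>x'\<in>neighbours G x. of_nat (card (joining G x x')) * coord f x'"
  obtain C where C: "\<And>f F. finite F \<Longrightarrow> L2_set (\<lambda>x. cmod (?g f x)) F \<le> norm f * C"
    using adjacency_finite_bound[OF assms] by blast
  have co: "coord (Abs_ell2 (?g f)) = ?g f" for f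
    using ell2_finite_bound(1)[OF C] by (simp add: Abs_ell2_inverse)
  have "bounded_linear (\<lambda>f. Abs_ell2 (?g f))"
  proof (rule bounded_linear_intro)
    fix f g :: "'a ell2" and r :: real
    show "Abs_ell2 (?g (f + g)) = Abs_ell2 (?g f) + Abs_ell2 (?g g)"
      by (rule ell2_eqI, subst coord_plus, unfold co) (simp add: coord_plus distrib_left sum.distrib)
    show "Abs_ell2 (?g (r *\<^sub>R f)) = r *\<^sub>R Abs_ell2 (?g f)"
      by (rule ell2_eqI, subst scaleR_ell2.rep_eq, unfold co)
        (simp add: scaleR_ell2.rep_eq sum_distrib_left mult.left_commute)
    show "norm (Abs_ell2 (?g f)) \<le> norm f * C"
      using ell2_finite_bound(2)[OF C] by (simp add: norm_ell2.rep_eq co)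
  qed
  moreover have "Abs_ell2 (?g (cscale c f)) = cscale c (Abs_ell2 (?g f))" for c f
    by (rule ell2_eqI, subst coord_cscale, unfold co) (simp add: coord_cscale sum_distrib_left mult.left_commute)
  ultimately have "bop_apply (adjacency G) = (\<lambda>f. Abs_ell2 (?g f))"
    unfolding adjacency_def by (intro Abs_bop_inverse) simp
  then show ?thesis by (simp add: co)
qed

lemma coord_sum: "coord (\<Sum>i\<in>I. f i) x = (\<Sum>i\<in>I. coord (f i) x)"
  by (induction I rule: infinite_finite_induct) (auto simp: coord_plus zero_ell2.rep_eq)

lemma adjacency_delta:
  assumes "multigraph G" "bounded_degrees G"
  shows "bop_apply (adjacency G) (delta x) =
           (\<Sum>x'\<in>neighbours G x. cscale (of_nat (card (joining G x x'))) (delta x'))"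
proof (rule ell2_eqI)
  fix y
  obtain K where K: "\<And>x. finite (neighbours G x)" "\<And>x. card (neighbours G x) \<le> K"
    "\<And>x x'. finite (joining G x x')" "\<And>x x'. card (joining G x x') \<le> K"
    using neighbours_bounded[OF assms] by blast
  have sym: "joining G x y = joining G y x" by (simp add: joining_def insert_commute)
  show "coord (bop_apply (adjacency G) (delta x)) y =
      coord (\<Sum>x'\<in>neighbours G x. cscale (of_nat (card (joining G x x'))) (delta x')) y"
    by (simp add: coord_adjacency[OF assms] coord_sum coord_cscale delta.rep_eq K sym
        neighbours_sym[of x G] if_distrib[of "\<lambda>t. _ * t"] cong: if_cong)
qed

lemma multigraph_free_product:
  assumes "rooted_graph G1" "rooted_graph G2"
  shows "multigraph (free_product G1 G2)"
proof -
  have 1: "attach Inl (root_vertex G1) w v \<in> fp_verts G1 G2"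
    if "w \<in> fp_verts G1 G2" "w \<noteq> [] \<longrightarrow> letter_color (hd w) \<noteq> Color1" "v \<in> verts G1" for w v
    using that by (cases w) (auto simp: attach_def fp_verts_def)
  have 2: "attach Inr (root_vertex G2) w v \<in> fp_verts G1 G2"
    if "w \<in> fp_verts G1 G2" "w \<noteq> [] \<longrightarrow> letter_color (hd w) \<noteq> Color2" "v \<in> verts G2" for w v
    using that by (cases w) (auto simp: attach_def fp_verts_def)
  have m1: "\<exists>x\<in>verts G1. \<exists>x'\<in>verts G1. ends G1 \<beta> = {x, x'}" if "\<beta> \<in> edges G1" for \<beta>
    using assms(1) that by (auto simp: rooted_graph_def multigraph_def)
  have m2: "\<exists>x\<in>verts G2. \<exists>x'\<in>verts G2. ends G2 \<beta> = {x, x'}" if "\<beta> \<in> edges G2" for \<beta>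
    using assms(2) that by (auto simp: rooted_graph_def multigraph_def)
  show ?thesis
    unfolding multigraph_def
  proof
    fix b assume "b \<in> edges (free_product G1 G2)"
    then consider (l) w \<beta> where "b = (w, Inl \<beta>)" "w \<in> fp_verts G1 G2"
        "w \<noteq> [] \<longrightarrow> letter_color (hd w) \<noteq> Color1" "\<beta> \<in> edges G1"
      | (r) w \<beta> where "b = (w, Inr \<beta>)" "w \<in> fp_verts G1 G2"
        "w \<noteq> [] \<longrightarrow> letter_color (hd w) \<noteq> Color2" "\<beta> \<in> edges G2"
      by (auto simp: free_product_def)
    then show "\<exists>x\<in>verts (free_product G1 G2). \<exists>x'\<in>verts (free_product G1 G2).
        ends (free_product G1 G2) b = {x, x'}"
    proof cases
      case l
      obtain x x' where "x \<in> verts G1" "x' \<in> verts G1" "ends G1 \<beta> = {x, x'}" using m1 l by blast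
      with 1[OF l(2,3)] show ?thesis
        by (intro bexI[of _ "attach Inl (root_vertex G1) w x"]
            bexI[of _ "attach Inl (root_vertex G1) w x'"]) (auto simp: free_product_def l(1))
    next
      case r
      obtain x x' where "x \<in> verts G2" "x' \<in> verts G2" "ends G2 \<beta> = {x, x'}" using m2 r by blast
      with 2[OF r(2,3)] show ?thesis
        by (intro bexI[of _ "attach Inr (root_vertex G2) w x"]
            bexI[of _ "attach Inr (root_vertex G2) w x'"]) (auto simp: free_product_def r(1))
    qed
  qed
qed

lemma bounded_degrees_free_product:
  assumes "rooted_graph G1" "rooted_graph G2"
  shows "bounded_degrees (free_product G1 G2)"
proof -
  define I1 where "I1 x = {\<beta> \<in> edges G1. x \<in> ends G1 \<beta>}" for x
  define I2 where "I2 x = {\<beta> \<in> edges G2. x \<in> ends G2 \<beta>}" for x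
  let ?r1 = "root_vertex G1" and ?r2 = "root_vertex G2"
  obtain K1 where K1: "\<And>x. x \<in> verts G1 \<Longrightarrow> finite (I1 x) \<and> card (I1 x) \<le> K1"
    using assms(1) unfolding rooted_graph_def bounded_degrees_def I1_def by blast
  obtain K2 where K2: "\<And>x. x \<in> verts G2 \<Longrightarrow> finite (I2 x) \<and> card (I2 x) \<le> K2"
    using assms(2) unfolding rooted_graph_def bounded_degrees_def I2_def by blast
  have r: "?r1 \<in> verts G1" "?r2 \<in> verts G2" using assms by (auto simp: rooted_graph_def)
  show ?thesis
    unfolding bounded_degrees_def
  proof (intro exI[of _ "K1 + K2 + (K1 + K2)"] ballI)
    fix w assume "w \<in> verts (free_product G1 G2)"
    then have w: "w \<in> fp_verts G1 G2" by (simp add: free_product_def)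
    define B where "B = (case w of [] \<Rightarrow> {} | Inl v # w' \<Rightarrow> (\<lambda>\<beta>. (w', Inl \<beta>)) ` I1 v
      | Inr v # w' \<Rightarrow> (\<lambda>\<beta>. (w', Inr \<beta> :: 'b + 'd)) ` I2 v)"
    define A1 where "A1 = (\<lambda>\<beta>. (w, Inl \<beta> :: 'b + 'd)) ` I1 ?r1"
    define A2 where "A2 = (\<lambda>\<beta>. (w, Inr \<beta> :: 'b + 'd)) ` I2 ?r2"
    have sub: "{b \<in> edges (free_product G1 G2). w \<in> ends (free_product G1 G2) b} \<subseteq> A1 \<union> A2 \<union> B"
      by (auto simp: free_product_def A1_def A2_def B_def attach_def I1_def I2_def split: if_splits)
    have A1: "finite A1 \<and> card A1 \<le> K1"
      using K1[OF r(1)] card_image_le[of "I1 ?r1"] unfolding A1_def by (meson finite_imageI le_trans)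
    have A2: "finite A2 \<and> card A2 \<le> K2"
      using K2[OF r(2)] card_image_le[of "I2 ?r2"] unfolding A2_def by (meson finite_imageI le_trans)
    have B: "finite B \<and> card B \<le> K1 + K2"
    proof (cases w)
      case (Cons a w')
      show ?thesis
      proof (cases a)
        case (Inl v)
        then have "v \<in> verts G1" using w Cons by (auto simp: fp_verts_def)
        from K1[OF this] show ?thesis
          using card_image_le[of "I1 v" "\<lambda>\<beta>. (w', Inl \<beta> :: 'b + 'd)"] Inl Cons by (auto simp: B_def)
      next
        case (Inr v)
        then have "v \<in> verts G2" using w Cons by (auto simp: fp_verts_def)
        from K2[OF this] show ?thesis
          using card_image_le[of "I2 v" "\<lambda>\<beta>. (w', Inr \<beta> :: 'b + 'd)"] Inr Cons by (auto simp: B_def)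
      qed
    qed (simp add: B_def)
    have "card (A1 \<union> A2 \<union> B) \<le> K1 + K2 + (K1 + K2)"
      using A1 A2 B card_Un_le[of A1 A2] card_Un_le[of "A1 \<union> A2" B] by linarith
    with sub A1 A2 B show "finite {b \<in> edges (free_product G1 G2). w \<in> ends (free_product G1 G2) b} \<and>
        card {b \<in> edges (free_product G1 G2). w \<in> ends (free_product G1 G2) b} \<le> K1 + K2 + (K1 + K2)"
      by (meson card_mono finite_UnI finite_subset le_trans)
  qed
qed

lemma color_subgraph_wf:
  assumes "multigraph G" "bounded_degrees G"
  shows "multigraph (color_subgraph G c i)" "bounded_degrees (color_subgraph G c i)"
proof -
  show "multigraph (color_subgraph G c i)"
    using assms(1) by (auto simp: multigraph_def color_subgraph_def)
  obtain K where K: "\<And>x. x \<in> verts G \<Longrightarrow> finite {\<beta> \<in> edges G. x \<in> ends G \<beta>}"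
      "\<And>x. x \<in> verts G \<Longrightarrow> card {\<beta> \<in> edges G. x \<in> ends G \<beta>} \<le> K"
    using assms(2) unfolding bounded_degrees_def by blast
  have sub: "{\<beta> \<in> edges (color_subgraph G c i). x \<in> ends (color_subgraph G c i) \<beta>}
      \<subseteq> {\<beta> \<in> edges G. x \<in> ends G \<beta>}" for x
    by (auto simp: color_subgraph_def)
  have "verts (color_subgraph G c i) = verts G" by (simp add: color_subgraph_def)
  then show "bounded_degrees (color_subgraph G c i)"
    unfolding bounded_degrees_def
    using finite_subset[OF sub K(1)] le_trans[OF card_mono[OF K(1) sub] K(2)] by auto
qed

lemma adjacency_color_decomposition:
  assumes "multigraph G" "bounded_degrees G"
  shows "adjacency G =
           adjacency (color_subgraph G c Color1) + adjacency (color_subgraph G c Color2)"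
proof -
  obtain K where K: "\<And>x. finite (neighbours G x)" "\<And>x. card (neighbours G x) \<le> K"
    "\<And>x x'. finite (joining G x x')" "\<And>x x'. card (joining G x x') \<le> K"
    using neighbours_bounded[OF assms] by blast
  let ?S = "color_subgraph G c"
  have sub: "joining (?S i) x x' \<subseteq> joining G x x'" for i x x'
    by (auto simp: joining_def color_subgraph_def)
  have "joining G x x' = joining (?S Color1) x x' \<union> joining (?S Color2) x x'" for x x'
    by (auto simp: joining_def color_subgraph_def) (metis color.exhaust)
  moreover have "joining (?S Color1) x x' \<inter> joining (?S Color2) x x' = {}" for x x'
    by (auto simp: joining_def color_subgraph_def)
  ultimately have card: "card (joining G x x') =
      card (joining (?S Color1) x x') + card (joining (?S Color2) x x')" for x x'
    using K(3) sub by (metis card_Un_disjoint finite_subset)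
  have ext: "(\<Sum>x'\<in>neighbours (?S i) x. of_nat (card (joining (?S i) x x')) * coord f x') =
      (\<Sum>x'\<in>neighbours G x. of_nat (card (joining (?S i) x x')) * coord f x')" for i f x
    by (rule sum.mono_neutral_left[OF K(1)]) (auto simp: neighbours_def dest: sub[THEN subsetD])
  have "bop_apply (adjacency G) f =
      bop_apply (adjacency (?S Color1)) f + bop_apply (adjacency (?S Color2)) f" for f
    by (rule ell2_eqI)
      (simp add: coord_plus coord_adjacency assms color_subgraph_wf ext card distrib_right
        sum.distrib)
  then show ?thesis
    by (intro iffD1[OF bop_apply_inject] HOL.ext) (simp add: plus_bop.rep_eq)
qed

end

(*
  Freeness: the operator of color i acts on each copy of the i-th graph as the adjacency matrix of
  that graph, and the copies of color i tile the free product. Hence a centred polynomial in it maps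
  a vector carried by words with color sequence cs, where cs does not begin with i, to a vector
  carried by words with color sequence i cs, and an alternating product of centred elements maps the
  root to a vector vanishing at the root. Since joint moments of free elements are determined by the
  marginals, S1 S2 has distribution mu1 [x] mu2.

  Counting: the n-th moments of S1 S2 and of S2 S1 both count the closed alternating walks of
  length 2n at the root that begin with color 1 (reverse the walks for S2 S1). An excursion from the
  root closes with the color of its first edge, so the first return of such a walk happens at an odd
  time and the second one at an even time: cutting at the second return splits off an alternating
  d-walk. The resulting renewal equation psi = D (1 + psi) says that the eta-series is the
  generating series D of the d-walks.
*)
theory Submission
  imports Defs
begin

section \<open>Polynomials in one element of an algebra\<close>

lemma scaleC_zero_left [simp]: "0 *\<^sub>C (x::'a::complex_algebra) = 0"
  using scaleC_add_left[of 0 0 x] by simp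

lemma scaleC_sum_right: "c *\<^sub>C (\<Sum>i\<in>I. f i) = (\<Sum>i\<in>I. c *\<^sub>C (f i :: 'a::complex_algebra))"
  by (induction I rule: infinite_finite_induct) (auto simp: scaleC_add_right)

lemma scaleC_uminus_one: "(-1) *\<^sub>C x = - (x::'a::complex_algebra)"
  using scaleC_add_left[of 1 "-1" x] by (simp add: scaleC_one eq_neg_iff_add_eq_0 add.commute)

text \<open>A summation range not tied to the degree lets polynomials of different degrees be
  compared coefficient by coefficient.\<close>

lemma poly_eval_upto:
  assumes "degree p < n"
  shows "poly_eval u p a = (\<Sum>i<n. coeff p i *\<^sub>C unital_power u a i)"
  unfolding poly_eval_def
  by (rule sum.mono_neutral_left) (use assms in \<open>auto simp: coeff_eq_0\<close>)

lemma poly_eval_0 [simp]: "poly_eval u 0 a = 0"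
  by (simp add: poly_eval_def)

lemma poly_eval_add: "poly_eval u (p + q) a = poly_eval u p a + poly_eval u q a"
proof -
  let ?n = "Suc (max (degree p) (degree q))"
  have "degree p < ?n" "degree q < ?n" "degree (p + q) < ?n"
    using degree_add_le_max[of p q] by auto
  then show ?thesis
    by (simp only: poly_eval_upto coeff_add scaleC_add_left sum.distrib)
qed

lemma poly_eval_smult: "poly_eval u (smult c p) a = c *\<^sub>C poly_eval u p a"
proof -
  have "degree (smult c p) < Suc (degree p)"
    using degree_smult_le[of c p] by auto
  then show ?thesis
    by (simp only: poly_eval_upto[of "smult c p"] poly_eval_upto[of p, OF lessI] coeff_smult
        scaleC_scaleC[symmetric] scaleC_sum_right)
qed

lemma poly_eval_pCons: "poly_eval u (pCons c p) a = c *\<^sub>C u + a * poly_eval u p a"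
proof -
  have "degree (pCons c p) < Suc (Suc (degree p))"
    using degree_pCons_le[of c p] by linarith
  then have "poly_eval u (pCons c p) a =
      (\<Sum>i<Suc (Suc (degree p)). coeff (pCons c p) i *\<^sub>C unital_power u a i)"
    by (rule poly_eval_upto)
  also have "\<dots> = c *\<^sub>C u + (\<Sum>i<Suc (degree p). coeff p i *\<^sub>C (a * unital_power u a i))"
    by (subst sum.lessThan_Suc_shift) simp
  also have "\<dots> = c *\<^sub>C u + a * poly_eval u p a"
    by (simp only: poly_eval_upto[OF lessI] sum_distrib_left mult_scaleC_right)
  finally show ?thesis .
qed

lemma poly_eval_monom: "poly_eval u (monom 1 n) a = unital_power u a n"
  by (induction n) (simp_all add: monom_0 monom_Suc poly_eval_pCons scaleC_one)

text \<open>The element \<open>u\<close> may be a mere projection in the ambient algebra, so its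
  acting as an identity on \<open>A\<close> is part of the definition. Negatives come from the
  scalar -1.\<close>

definition closed_subalgebra :: "'a::complex_algebra \<Rightarrow> 'a set \<Rightarrow> bool" where
  "closed_subalgebra u A \<longleftrightarrow> u \<in> A \<and> (\<forall>x\<in>A. u * x = x \<and> x * u = x) \<and>
     (\<forall>x\<in>A. \<forall>y\<in>A. x + y \<in> A \<and> x * y \<in> A) \<and> (\<forall>c. \<forall>x\<in>A. c *\<^sub>C x \<in> A)"

text \<open>The hypotheses put \<open>a\<close> into the corner cut out by the idempotent
  \<open>u\<close>. Evaluation at such an element is a unital homomorphism on polynomials, so its
  range is a subalgebra with unit \<open>u\<close>.\<close>

lemma generated_algebra_closed:
  assumes "u * u = u" "u * a = a" "a * u = a"
  shows "closed_subalgebra u (generated_algebra u a)"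
proof -
  have u: "poly_eval u [:1:] a = u"
    by (simp add: poly_eval_pCons scaleC_one)
  have lu: "u * poly_eval u p a = poly_eval u p a" for p
    by (induction p)
      (simp_all add: poly_eval_pCons distrib_left mult_scaleC_right mult.assoc[symmetric] assms)
  have ru: "poly_eval u p a * u = poly_eval u p a" for p
    by (induction p) (simp_all add: poly_eval_pCons distrib_right mult_scaleC_left mult.assoc assms)
  have mult: "poly_eval u (p * q) a = poly_eval u p a * poly_eval u q a" for p q
  proof (induction p)
    case (pCons c p)
    then show ?case
      by (simp add: poly_eval_add poly_eval_smult poly_eval_pCons distrib_right mult_scaleC_left lu
          mult.assoc)
  qed simp
  have "u \<in> generated_algebra u a"
    unfolding generated_algebra_def using u by (metis rangeI)
  moreover have "x + y \<in> generated_algebra u a \<and> x * y \<in> generated_algebra u a"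
    if "x \<in> generated_algebra u a" "y \<in> generated_algebra u a" for x y
    using that unfolding generated_algebra_def
    by (auto simp: mult[symmetric] poly_eval_add[symmetric])
  moreover have "c *\<^sub>C x \<in> generated_algebra u a" if "x \<in> generated_algebra u a" for c x
    using that unfolding generated_algebra_def by (auto simp: poly_eval_smult[symmetric])
  moreover have "u * x = x \<and> x * u = x" if "x \<in> generated_algebra u a" for x
    using that unfolding generated_algebra_def by (auto simp: lu ru)
  ultimately show ?thesis
    unfolding closed_subalgebra_def by blast
qed

lemma generator_in_generated_algebra:
  assumes "a * u = a"
  shows "a \<in> generated_algebra u a"
proof -
  have "poly_eval u [:0, 1:] a = a"
    by (simp add: poly_eval_pCons scaleC_one assms)
  then show ?thesis
    unfolding generated_algebra_def by (metis rangeI)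
qed

lemma closed_subalgebra_diff:
  assumes "closed_subalgebra u A" "x \<in> A" "y \<in> A"
  shows "x - y \<in> A"
proof -
  have "x + (-1) *\<^sub>C y \<in> A"
    using assms unfolding closed_subalgebra_def by blast
  then show ?thesis by (simp add: scaleC_uminus_one)
qed

lemma generated_algebra_subset:
  assumes A: "closed_subalgebra u A" and "b \<in> A"
  shows "generated_algebra u b \<subseteq> A"
proof -
  have "0 *\<^sub>C u \<in> A"
    using A unfolding closed_subalgebra_def by blast
  then have "poly_eval u p b \<in> A" for p
    by (induction p) (use A \<open>b \<in> A\<close> in \<open>auto simp: poly_eval_pCons closed_subalgebra_def\<close>)
  then show ?thesis
    by (auto simp: generated_algebra_def)
qed

lemma free_subalgebras_mono:
  assumes "free_subalgebras u \<phi> A" "\<And>i. B i \<subseteq> A i"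
  shows "free_subalgebras u \<phi> B"
  using assms unfolding free_subalgebras_def by blast


section \<open>Joint moments of free families are determined by the marginals\<close>

lemma unital_functional_rules:
  assumes "unital_functional u \<phi>"
  shows "\<phi> (a + b) = \<phi> a + \<phi> b" "\<phi> (c *\<^sub>C a) = c * \<phi> a" "\<phi> u = 1"
  using assms by (auto simp: unital_functional_def)

lemma unital_functional_diff:
  assumes "unital_functional u \<phi>"
  shows "\<phi> (a - b) = \<phi> a - \<phi> b"
  using unital_functional_rules(1)[OF assms, of "a - b" b] by simp

lemma foldr_mult_append:
  fixes u :: "'a::complex_algebra"
  assumes "\<And>x. u * x = x"
  shows "foldr (*) (xs @ ys) u = foldr (*) xs u * foldr (*) ys u"
  by (induction xs) (simp_all add: assms mult.assoc)

text \<open>Adjacent factors from the same subalgebra are merged; a factor \<open>a\<close> with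
  nonzero value is split into its centred part and \<open>\<phi> a\<close> times the unit. If
  neither applies, the product is alternating and centred, and freeness makes both functionals
  vanish on it; since they agree on each \<open>A i\<close>, centred means the same for
  both.\<close>

lemma free_functionals_agree_on_products:
  fixes u :: "'a::complex_algebra"
  assumes u: "\<And>x. u * x = x" "\<And>x. x * u = x"
    and un: "unital_functional u \<phi>" "unital_functional u \<phi>'"
    and fr: "free_subalgebras u \<phi> A" "free_subalgebras u \<phi>' A"
    and A: "\<And>i. closed_subalgebra u (A i)"
    and eq: "\<And>i a. a \<in> A i \<Longrightarrow> \<phi> a = \<phi>' a"
    and len: "length as = length is" and mem: "\<forall>j<length is. as ! j \<in> A (is ! j)"
  shows "\<phi> (foldr (*) as u) = \<phi>' (foldr (*) as u)"
  using len mem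
\<comment> \<open>Lexicographic measure: merging or dropping a factor shortens the word, while
  centring keeps its length but leaves one factor fewer with nonzero value.\<close>
proof (induction "(length is, card {j. j < length is \<and> \<phi> (as ! j) \<noteq> 0})" arbitrary: "is" "as" rule:
    wf_induct_rule[OF wf_lex_prod[OF wf_less_than wf_less_than], case_names step])
  case (step "is" "as")
  let ?P = "foldr (*)"
  let ?bad = "{j. j < length is \<and> \<phi> (as ! j) \<noteq> 0}"
  \<comment> \<open>The index word \<open>ks\<close> may have equal neighbours, as happens after a
    deletion.\<close>
  have shorter: "\<phi> (?P bs u) = \<phi>' (?P bs u)"
    if "length ks < length is" "length bs = length ks" "\<forall>j<length ks. bs ! j \<in> A (ks ! j)" for bs ks
    using step(1)[OF _ that(2,3)] that(1) by simp
  note mem = step(3)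
  consider (empty) "is = []" | (adj) "is \<noteq> []" "\<not> distinct_adj is"
    | (centred) "is \<noteq> []" "distinct_adj is" "?bad = {}"
    | (uncentred) j where "j \<in> ?bad"
    by blast
  then show ?case
  proof cases
    case empty
    then show ?thesis using step(2) un by (simp add: unital_functional_rules)
  next
    case adj
    then obtain j where j: "Suc j < length is" "is ! j = is ! Suc j"
      by (auto simp: distinct_adj_conv_nth)
    define xs ys a b where "xs = take j as" and "ys = drop (Suc (Suc j)) as"
      and "a = as ! j" and "b = as ! Suc j"
    have as: "as = xs @ a # b # ys"
      unfolding xs_def ys_def a_def b_def using j step(2) by (simp add: Cons_nth_drop_Suc)
    define ks where "ks = take j is @ is ! j # drop (Suc (Suc j)) is"
    have lxs: "length xs = j" using j step(2) by (simp add: xs_def)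
    have ab: "a * b \<in> A (is ! j)"
      using A[of "is ! j"] mem j unfolding closed_subalgebra_def a_def b_def
      by (metis Suc_lessD)
    have "\<phi> (?P (xs @ (a * b) # ys) u) = \<phi>' (?P (xs @ (a * b) # ys) u)"
    proof (rule shorter[of ks])
      show "length ks < length is" "length (xs @ (a * b) # ys) = length ks"
        using j step(2) by (auto simp: ks_def xs_def ys_def)
      show "\<forall>i<length ks. (xs @ (a * b) # ys) ! i \<in> A (ks ! i)"
        using j step(2) mem ab
        by (auto simp: ks_def xs_def ys_def nth_append nth_Cons split: nat.split)
    qed
    then show ?thesis
      by (simp add: as mult.assoc)
  next
    case centred
    then have 0: "\<forall>j<length is. as ! j \<in> A (is ! j) \<and> \<phi> (as ! j) = 0"
      using mem by auto
    then have c': "\<forall>j<length is. as ! j \<in> A (is ! j) \<and> \<phi>' (as ! j) = 0"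
      using eq by metis
    show ?thesis
      using fr[unfolded free_subalgebras_def, rule_format, of "is" "as"] centred(1,2) step(2) 0 c'
      by simp
  next
    case uncentred
    then have j: "j < length is" "\<phi> (as ! j) \<noteq> 0" by auto
    define xs ys a where "xs = take j as" and "ys = drop (Suc j) as" and "a = as ! j"
    define a0 where "a0 = a - \<phi> a *\<^sub>C u"
    have as: "as = xs @ a # ys"
      unfolding xs_def ys_def a_def using j step(2) by (simp add: id_take_nth_drop)
    have lxs: "length xs = j" using j step(2) by (simp add: xs_def)
    have aA: "a \<in> A (is ! j)" using mem j by (simp add: a_def)
    have a0A: "a0 \<in> A (is ! j)"
      unfolding a0_def using A[of "is ! j"] aA
      by (intro closed_subalgebra_diff[OF A]) (auto simp: closed_subalgebra_def)
    have phi_a0: "\<phi> a0 = 0"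
      unfolding a0_def using un by (simp add: unital_functional_diff unital_functional_rules)
    have a: "a = a0 + \<phi> a *\<^sub>C u" by (simp add: a0_def)
    have split: "?P as u = ?P (xs @ a0 # ys) u + \<phi> a *\<^sub>C ?P (xs @ ys) u"
      unfolding as by (subst a) (simp only: foldr_mult_append[OF u(1)] foldr.simps o_apply
          distrib_left distrib_right mult_scaleC_left mult_scaleC_right u)
    have memj: "\<forall>i<length is. (xs @ a0 # ys) ! i \<in> A (is ! i)"
      using j step(2) mem a0A unfolding xs_def ys_def
      by (subst upd_conv_take_nth_drop[symmetric]) (auto simp: nth_list_update)
    have len: "length (xs @ a0 # ys) = length is"
      using j step(2) by (auto simp: xs_def ys_def)
    have "{i. i < length is \<and> \<phi> ((xs @ a0 # ys) ! i) \<noteq> 0} \<subseteq> ?bad - {j}"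
      using phi_a0 lxs by (auto simp: as nth_append nth_Cons split: if_splits nat.splits)
    moreover have "finite ?bad" by simp
    ultimately have "card {i. i < length is \<and> \<phi> ((xs @ a0 # ys) ! i) \<noteq> 0} < card ?bad"
      by (intro psubset_card_mono) (use uncentred in auto)
    then have 1: "\<phi> (?P (xs @ a0 # ys) u) = \<phi>' (?P (xs @ a0 # ys) u)"
      by (intro step(1)[OF _ len memj]) simp
    have 2: "\<phi> (?P (xs @ ys) u) = \<phi>' (?P (xs @ ys) u)"
    proof (rule shorter[of "take j is @ drop (Suc j) is"])
      show "\<forall>i<length (take j is @ drop (Suc j) is).
          (xs @ ys) ! i \<in> A ((take j is @ drop (Suc j) is) ! i)"
        using j step(2) mem by (auto simp: xs_def ys_def nth_append)
    qed (use j step(2) in \<open>auto simp: xs_def ys_def\<close>)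
    show ?thesis
      unfolding split using 1 2 un by (simp add: unital_functional_rules)
  qed
qed


section \<open>Evaluating noncommutative polynomials\<close>

fun word_eval :: "'a::complex_algebra \<Rightarrow> ('x \<Rightarrow> 'a) \<Rightarrow> 'x free_monoid \<Rightarrow> 'a" where
  "word_eval u S (Word l) = foldr (*) (map S l) u"

text \<open>The map given by the universal property of the free algebra: variables go to
  \<open>S i\<close> and the unit to \<open>u\<close>, once these satisfy the unit laws assumed in
  the context below.\<close>

definition nc_eval :: "'a::complex_algebra \<Rightarrow> (color \<Rightarrow> 'a) \<Rightarrow> ncpoly \<Rightarrow> 'a" where
  "nc_eval u S p = (\<Sum>w\<in>Poly_Mapping.keys p. Poly_Mapping.lookup p w *\<^sub>C word_eval u S w)"

text \<open>A finitely supported function is the sum of its point masses, so additive properties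
  only have to be checked on monomials.\<close>

lemma ncpoly_induct [case_names zero single add]:
  fixes p :: "'k \<Rightarrow>\<^sub>0 'b::comm_monoid_add"
  assumes "P 0" "\<And>w c. P (Poly_Mapping.single w c)" "\<And>p q. P p \<Longrightarrow> P q \<Longrightarrow> P (p + q)"
  shows "P p"
proof -
  have "P (\<Sum>w\<in>F. Poly_Mapping.single w (Poly_Mapping.lookup p w))" for F
    by (induction F rule: infinite_finite_induct) (auto intro: assms)
  from this[of "Poly_Mapping.keys p"] show ?thesis
    by (rule back_subst[of P])
      (rule poly_mapping_eqI, simp add: lookup_sum lookup_single when_def in_keys_iff)
qed

lemma nc_eval_superset:
  assumes "finite F" "Poly_Mapping.keys p \<subseteq> F"
  shows "nc_eval u S p = (\<Sum>w\<in>F. Poly_Mapping.lookup p w *\<^sub>C word_eval u S w)"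
  unfolding nc_eval_def
  by (rule sum.mono_neutral_left) (use assms in \<open>auto simp: in_keys_iff\<close>)

lemma nc_eval_0 [simp]: "nc_eval u S 0 = 0"
  by (simp add: nc_eval_def)

lemma nc_eval_add: "nc_eval u S (p + q) = nc_eval u S p + nc_eval u S q"
proof -
  let ?F = "Poly_Mapping.keys p \<union> Poly_Mapping.keys q"
  have "nc_eval u S r = (\<Sum>w\<in>?F. Poly_Mapping.lookup r w *\<^sub>C word_eval u S w)"
    if "Poly_Mapping.keys r \<subseteq> ?F" for r
    by (rule nc_eval_superset) (use that in auto)
  moreover have "Poly_Mapping.keys (p + q) \<subseteq> ?F" by (rule Poly_Mapping.keys_add)
  ultimately show ?thesis
    by (simp add: lookup_add scaleC_add_left sum.distrib)
qed

lemma nc_eval_single: "nc_eval u S (Poly_Mapping.single w c) = c *\<^sub>C word_eval u S w"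
  by (subst nc_eval_superset[of "{w}"]) auto

lemma scaleC_single: "c *\<^sub>C Poly_Mapping.single w d = Poly_Mapping.single w (c *\<^sub>C d)"
  by (rule poly_mapping_eqI) (simp add: scaleC_poly_mapping.rep_eq lookup_single when_def)

lemma nc_eval_scaleC: "nc_eval u S (c *\<^sub>C p) = c *\<^sub>C nc_eval u S p"
  by (induction p rule: ncpoly_induct)
    (simp_all add: nc_eval_single nc_eval_add scaleC_add_right scaleC_single scaleC_scaleC
      scaleC_complex_def)

section \<open>Evaluation as a unital homomorphism into a corner\<close>

context
  fixes u :: "'a::complex_algebra" and S :: "color \<Rightarrow> 'a"
  assumes uu: "u * u = u" and uS: "\<And>i. u * S i = S i" and Su: "\<And>i. S i * u = S i"
begin

text \<open>The product of the two values has an extra \<open>u\<close> between the blocks;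
  \<open>uu\<close> and \<open>uS\<close> absorb it.\<close>

lemma word_eval_plus: "word_eval u S (w + w') = word_eval u S w * word_eval u S w'"
proof -
  have u: "u * foldr (*) (map S l) u = foldr (*) (map S l) u" for l
    by (cases l) (simp_all add: uu uS mult.assoc[symmetric])
  have "foldr (*) (map S (l @ l')) u = foldr (*) (map S l) u * foldr (*) (map S l') u" for l l'
    by (induction l) (simp_all add: u mult.assoc flip: foldr_append)
  then show ?thesis
    by (cases w; cases w') simp
qed

lemma nc_eval_mult: "nc_eval u S (p * q) = nc_eval u S p * nc_eval u S q"
proof (induction p rule: ncpoly_induct)
  case (single w c)
  show ?case
    by (induction q rule: ncpoly_induct)
      (simp_all add: mult_single nc_eval_single nc_eval_add distrib_left word_eval_plus
        mult_scaleC_left mult_scaleC_right scaleC_scaleC mult.commute)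
qed (simp_all add: nc_eval_add distrib_right)

lemma nc_eval_1: "nc_eval u S 1 = u"
  by (simp add: nc_eval_single scaleC_one zero_free_monoid_def flip: single_one)

lemma nc_eval_ncvar: "nc_eval u S (ncvar i) = S i"
  by (simp add: ncvar_def nc_eval_single scaleC_one Su)

lemma nc_eval_poly_eval: "nc_eval u S (poly_eval 1 p x) = poly_eval u p (nc_eval u S x)"
  by (induction p)
    (simp_all add: poly_eval_pCons nc_eval_add nc_eval_mult nc_eval_scaleC nc_eval_1)

lemma nc_eval_foldr: "nc_eval u S (foldr (*) xs 1) = foldr (*) (map (nc_eval u S) xs) u"
  by (induction xs) (simp_all add: nc_eval_mult nc_eval_1)

end

text \<open>This justifies the definite description in \<open>free_product_functional\<close>. A
  monomial is a product of variables, each from its own generated algebra, so the reduction for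
  products applies; linearity does the rest.\<close>

lemma free_product_functional_unique:
  assumes "unital_functional 1 \<phi>" "unital_functional 1 \<phi>'"
    and "free_pair 1 \<phi> (ncvar Color1) (ncvar Color2)" "free_pair 1 \<phi>' (ncvar Color1) (ncvar Color2)"
    and dist: "\<And>i. distribution 1 \<phi> (ncvar i) = distribution 1 \<phi>' (ncvar i)"
  shows "\<phi> = \<phi>'"
proof
  define A where "A i = generated_algebra 1 (ncvar i)" for i
  have A: "case_color (A Color1) (A Color2) = A"
    by (rule ext) (simp split: color.split)
  have word: "\<phi> (foldr (*) (map ncvar l) 1) = \<phi>' (foldr (*) (map ncvar l) 1)" for l
  proof (rule free_functionals_agree_on_products)
    show "unital_functional 1 \<phi>" "unital_functional 1 \<phi>'" by fact+
    show "free_subalgebras 1 \<phi> A" "free_subalgebras 1 \<phi>' A"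
      using assms(3,4) by (simp_all add: free_pair_def A flip: A_def)
    show "closed_subalgebra 1 (A i)" for i
      unfolding A_def by (rule generated_algebra_closed) simp_all
    show "\<phi> a = \<phi>' a" if "a \<in> A i" for i a
      using that dist[of i, THEN fun_cong] by (auto simp: A_def generated_algebra_def distribution_def)
    show "\<forall>j<length l. map ncvar l ! j \<in> A (l ! j)"
      by (simp add: A_def generator_in_generated_algebra)
  qed simp_all
  have word_single: "Poly_Mapping.single (Word l) 1 = foldr (*) (map ncvar l) 1" for l
  proof (induction l)
    case (Cons i l)
    have "Poly_Mapping.single (Word (i # l)) (1::complex) = ncvar i * Poly_Mapping.single (Word l) 1"
      by (simp add: ncvar_def mult_single)
    with Cons show ?case by simp
  qed (simp flip: single_one zero_free_monoid_def)
  show "\<phi> p = \<phi>' p" for p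
  proof (induction p rule: ncpoly_induct)
    case zero
    show ?case
      using unital_functional_rules(2)[OF assms(1), of 0 0]
        unital_functional_rules(2)[OF assms(2), of 0 0] by simp
  next
    case (single w c)
    obtain l where w: "w = Word l" by (cases w)
    have "Poly_Mapping.single w c = c *\<^sub>C foldr (*) (map ncvar l) 1"
      unfolding w word_single[symmetric] by (simp add: scaleC_single scaleC_complex_def)
    then show ?case
      using word[of l] assms(1,2) by (simp add: unital_functional_rules)
  next
    case (add p q)
    then show ?case using assms(1,2) by (simp add: unital_functional_rules)
  qed
qed

text \<open>The pair \<open>a1\<close>, \<open>a2\<close> itself supplies existence: pulling \<phi>
  back along \<open>nc_eval\<close> gives a functional under which the variables are free with the
  prescribed distributions. Uniqueness identifies it with \<open>free_product_functional\<close>,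
  and the product of the variables evaluates to \<open>a1 * a2\<close>.\<close>

lemma free_mult_conv_distribution:
  assumes uu: "u * u = u" and u1: "u * a1 = a1" "a1 * u = a1" and u2: "u * a2 = a2" "a2 * u = a2"
    and un: "unital_functional u \<phi>" and fr: "free_pair u \<phi> a1 a2"
  shows "distribution u \<phi> a1 \<boxtimes> distribution u \<phi> a2 = distribution u \<phi> (a1 * a2)"
proof -
  define S where "S = case_color a1 a2"
  have S: "u * S i = S i" "S i * u = S i" for i
    by (cases i; simp add: S_def u1 u2)+
  note ev = nc_eval_mult[of u S, OF uu S] nc_eval_1[of u S, OF uu S]
    nc_eval_ncvar[of u S, OF uu S] nc_eval_poly_eval[of u S, OF uu S] nc_eval_foldr[of u S, OF uu S]
  define \<psi> where "\<psi> p = \<phi> (nc_eval u S p)" for p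
  have un': "unital_functional 1 \<psi>"
    using un by (simp add: unital_functional_def \<psi>_def nc_eval_add nc_eval_scaleC ev)
  have dist: "distribution 1 \<psi> p = distribution u \<phi> (nc_eval u S p)" for p
    by (simp add: distribution_def \<psi>_def ev)
  have S12: "S Color1 = a1" "S Color2 = a2" by (simp_all add: S_def)
  have fr': "free_pair 1 \<psi> (ncvar Color1) (ncvar Color2)"
    unfolding free_pair_def free_subalgebras_def
  proof (intro allI impI)
    let ?A = "case_color (generated_algebra 1 (ncvar Color1)) (generated_algebra 1 (ncvar Color2))"
    let ?B = "case_color (generated_algebra u a1) (generated_algebra u a2)"
    fix "is" :: "color list" and as :: "ncpoly list"
    assume *: "is \<noteq> [] \<and> length as = length is \<and> distinct_adj is \<and>
      (\<forall>j<length is. as ! j \<in> ?A (is ! j) \<and> \<psi> (as ! j) = 0)"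
    \<comment> \<open>Evaluation carries the algebra of each variable into that of the corresponding
      element and preserves values, so centred alternating tuples stay centred and
      alternating.\<close>
    have img: "nc_eval u S x \<in> ?B i" if x: "x \<in> ?A i" for x i
    proof -
      obtain p where "x = poly_eval 1 p (ncvar i)"
        using x by (cases i) (auto simp: generated_algebra_def)
      then have "nc_eval u S x = poly_eval u p (S i)" by (simp add: ev)
      then show ?thesis by (cases i) (simp_all add: S_def generated_algebra_def)
    qed
    have "\<phi> (foldr (*) (map (nc_eval u S) as) u) = 0"
      using fr[unfolded free_pair_def free_subalgebras_def, rule_format,
          of "is" "map (nc_eval u S) as"] * img
      by (simp add: \<psi>_def)
    then show "\<psi> (foldr (*) as 1) = 0" by (simp add: \<psi>_def ev)
  qed
  have "free_product_functional (distribution u \<phi> a1) (distribution u \<phi> a2) = \<psi>"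
    unfolding free_product_functional_def
  proof (rule the_equality)
    show "unital_functional 1 \<psi> \<and> free_pair 1 \<psi> (ncvar Color1) (ncvar Color2) \<and>
        distribution 1 \<psi> (ncvar Color1) = distribution u \<phi> a1 \<and>
        distribution 1 \<psi> (ncvar Color2) = distribution u \<phi> a2"
      using un' fr' by (simp add: dist ev S12)
    fix \<theta>
    assume \<theta>: "unital_functional 1 \<theta> \<and> free_pair 1 \<theta> (ncvar Color1) (ncvar Color2) \<and>
        distribution 1 \<theta> (ncvar Color1) = distribution u \<phi> a1 \<and>
        distribution 1 \<theta> (ncvar Color2) = distribution u \<phi> a2"
    show "\<theta> = \<psi>"
    proof (rule free_product_functional_unique)
      show "distribution 1 \<theta> (ncvar i) = distribution 1 \<psi> (ncvar i)" for i
        using \<theta> by (cases i) (simp_all add: dist ev S12)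
    qed (use \<theta> un' fr' in auto)
  qed
  then show ?thesis
    by (simp add: free_mult_conv_def dist ev S12)
qed


section \<open>Operators of a graph that is tiled by copies of another graph\<close>

lemma bop_apply_simps:
  "bop_apply (S + T) f = bop_apply S f + bop_apply T f"
  "bop_apply (S * T) f = bop_apply S (bop_apply T f)"
  "bop_apply (c *\<^sub>C T) f = cscale c (bop_apply T f)"
  "bop_apply 0 f = 0"
  by (simp_all add: plus_bop.rep_eq times_bop.rep_eq scaleC_bop.rep_eq zero_bop.rep_eq)

lemma bop_apply_cscale: "bop_apply T (cscale c f) = cscale c (bop_apply T f)"
  using bop_apply[of T] by auto

lemma bop_eqI: "(\<And>f x. coord (bop_apply S f) x = coord (bop_apply T f) x) \<Longrightarrow> S = T"
  by (intro iffD1[OF bop_apply_inject] HOL.ext ell2_eqI)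

lemma coord_unit_op: "coord (bop_apply (unit_op V) f) x = (if x \<in> V then coord f x else 0)"
  by (simp add: unit_op.rep_eq restrict_ell2.rep_eq)

lemma vector_state_coord: "vector_state e T = coord (bop_apply T (delta e)) e"
proof -
  have "(\<Sum>\<^sub>\<infinity>x. f x * cnj (if x = e then 1 else 0)) = (\<Sum>\<^sub>\<infinity>x\<in>{e}. f x)" for f :: "'a \<Rightarrow> complex"
    by (rule infsum_cong_neutral) auto
  then show ?thesis
    by (simp add: vector_state_def inner_ell2.rep_eq delta.rep_eq)
qed

lemma unital_functional_vector_state:
  assumes "e \<in> V"
  shows "unital_functional (unit_op V) (vector_state e)"
  using assms
  by (simp add: unital_functional_def vector_state_coord bop_apply_simps coord_plus coord_cscale
      coord_unit_op delta.rep_eq)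

lemma unit_op_idem: "unit_op V * unit_op V = unit_op V"
  by (rule bop_eqI) (simp add: bop_apply_simps coord_unit_op)

lemma neighbours_verts:
  assumes "multigraph G" "x' \<in> neighbours G x"
  shows "x \<in> verts G" "x' \<in> verts G"
proof -
  obtain \<beta> where \<beta>: "\<beta> \<in> edges G" "ends G \<beta> = {x, x'}"
    using assms(2) by (auto simp: neighbours_def joining_def)
  then obtain y y' where "y \<in> verts G" "y' \<in> verts G" "ends G \<beta> = {y, y'}"
    using assms(1) unfolding multigraph_def by blast
  with \<beta> show "x \<in> verts G" "x' \<in> verts G" by (auto simp: doubleton_eq_iff)
qed

text \<open>Edges of a multigraph end in vertices, so the matrix is supported on vertices in both
  indices.\<close>

lemma adjacency_unit_op:
  assumes G: "multigraph G" "bounded_degrees G"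
  shows "unit_op (verts G) * adjacency G = adjacency G" "adjacency G * unit_op (verts G) = adjacency G"
proof -
  show "unit_op (verts G) * adjacency G = adjacency G"
  proof (rule bop_eqI)
    fix f x
    have "neighbours G x = {}" if "x \<notin> verts G"
      using neighbours_verts(1)[OF G(1)] that by blast
    then show "coord (bop_apply (unit_op (verts G) * adjacency G) f) x = coord (bop_apply (adjacency G) f) x"
      by (auto simp: bop_apply_simps coord_unit_op coord_adjacency[OF G])
  qed
  show "adjacency G * unit_op (verts G) = adjacency G"
    by (rule bop_eqI)
      (auto simp: bop_apply_simps coord_unit_op coord_adjacency[OF G] neighbours_verts(2)[OF G(1)]
        intro!: sum.cong)
qed

text \<open>The condition on neighbours makes the image a union of components of \<open>H\<close>.
  Multiplicities are compared by cardinality, which is all that the adjacency matrix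
  records.\<close>

definition copy_of :: "('x, 'b) rgraph \<Rightarrow> ('v, 'e) rgraph \<Rightarrow> ('x \<Rightarrow> 'v) \<Rightarrow> bool" where
  "copy_of K H j \<longleftrightarrow> inj_on j (verts K) \<and> j ` verts K \<subseteq> verts H \<and>
     (\<forall>v\<in>verts K. neighbours H (j v) \<subseteq> j ` verts K \<and>
       (\<forall>v'\<in>verts K. card (joining H (j v) (j v')) = card (joining K v v')))"

definition agree_along :: "('x, 'b) rgraph \<Rightarrow> ('x \<Rightarrow> 'v) \<Rightarrow> 'v ell2 \<Rightarrow> 'x ell2 \<Rightarrow> bool" where
  "agree_along K j f g \<longleftrightarrow> (\<forall>v\<in>verts K. coord f (j v) = coord g v)"

text \<open>All neighbours of a vertex of the copy lie in the copy, with unchanged multiplicities,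
  so the sum for \<open>H\<close> at \<open>j v\<close> reindexes to the one for \<open>K\<close> at
  \<open>v\<close>; values of \<open>f\<close> off the copy do not enter.\<close>

lemma agree_along_adjacency:
  assumes K: "multigraph K" "bounded_degrees K" and H: "multigraph H" "bounded_degrees H"
    and j: "copy_of K H j" and fg: "agree_along K j f g"
  shows "agree_along K j (bop_apply (adjacency H) f) (bop_apply (adjacency K) g)"
  unfolding agree_along_def
proof
  fix v assume v: "v \<in> verts K"
  have sub: "neighbours K v \<subseteq> verts K"
    using neighbours_verts(2)[OF K(1)] by blast
  \<comment> \<open>\<open>card\<close> is 0 on infinite sets as well, so finiteness is what turns
    equal cardinalities into simultaneous emptiness.\<close>
  have nb: "v' \<in> neighbours K v \<longleftrightarrow> j v' \<in> neighbours H (j v)" if "v' \<in> verts K" for v'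
  proof -
    have fin: "finite (joining K v v')" "finite (joining H (j v) (j v'))"
      using neighbours_bounded[OF K] neighbours_bounded[OF H] by blast+
    have "card (joining H (j v) (j v')) = card (joining K v v')"
      using j v that by (simp add: copy_of_def)
    then have "joining H (j v) (j v') = {} \<longleftrightarrow> joining K v v' = {}"
      using card_0_eq[OF fin(1)] card_0_eq[OF fin(2)] by simp
    then show ?thesis
      by (simp add: neighbours_def)
  qed
  have "neighbours H (j v) = j ` neighbours K v"
    using j v sub nb unfolding copy_of_def by blast
  moreover have "inj_on j (neighbours K v)"
    using j sub unfolding copy_of_def by (meson inj_on_subset)
  ultimately have "coord (bop_apply (adjacency H) f) (j v) =
      (\<Sum>v'\<in>neighbours K v. of_nat (card (joining H (j v) (j v'))) * coord f (j v'))"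
    by (simp add: coord_adjacency[OF H] sum.reindex)
  also have "\<dots> = (\<Sum>v'\<in>neighbours K v. of_nat (card (joining K v v')) * coord g v')"
    by (rule sum.cong[OF refl])
      (use j v sub fg in \<open>auto simp: copy_of_def agree_along_def subset_iff\<close>)
  finally show "coord (bop_apply (adjacency H) f) (j v) = coord (bop_apply (adjacency K) g) v"
    by (simp add: coord_adjacency[OF K])
qed

lemma agree_along_poly_eval:
  assumes K: "multigraph K" "bounded_degrees K" and H: "multigraph H" "bounded_degrees H"
    and j: "copy_of K H j" and fg: "agree_along K j f g"
  shows "agree_along K j (bop_apply (poly_eval (unit_op (verts H)) p (adjacency H)) f)
    (bop_apply (poly_eval (unit_op (verts K)) p (adjacency K)) g)"
proof (induction p)
  case 0
  show ?case by (simp add: agree_along_def bop_apply_simps zero_ell2.rep_eq)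
next
  case (pCons c p)
  have "agree_along K j (bop_apply (unit_op (verts H)) f) (bop_apply (unit_op (verts K)) g)"
    using j fg by (auto simp: agree_along_def copy_of_def coord_unit_op)
  with agree_along_adjacency[OF K H j pCons.IH] show ?case
    by (simp add: agree_along_def poly_eval_pCons bop_apply_simps coord_plus coord_cscale)
qed

section \<open>Tilings of a set of words by copies of one graph\<close>

context
  fixes K :: "('x, 'b) rgraph" and H :: "(('v, 'w) word, 'e) rgraph"
    and emb :: "'x \<Rightarrow> 'v + 'w" and W :: "('v, 'w) word set" and i :: color
  assumes K: "multigraph K" "bounded_degrees K" "root_vertex K \<in> verts K"
    and H: "multigraph H" "bounded_degrees H"
    and Nil_W: "[] \<in> W"
    and copies: "\<And>w. w \<in> W \<Longrightarrow> copy_of K H (attach emb (root_vertex K) w)"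
    and cover: "\<And>x. x \<in> verts H \<Longrightarrow> \<exists>w\<in>W. \<exists>v\<in>verts K. x = attach emb (root_vertex K) w v"
    and emb_color: "\<And>v. letter_color (emb v) = i"
begin

text \<open>Along the copy based at the empty word, \<open>delta []\<close> restricts to
  \<open>delta (root_vertex K)\<close>, so the two polynomials act on matching vectors.\<close>

lemma vector_state_poly_eval_copy:
  "vector_state [] (poly_eval (unit_op (verts H)) p (adjacency H)) =
   vector_state (root_vertex K) (poly_eval (unit_op (verts K)) p (adjacency K))"
proof -
  have "agree_along K (attach emb (root_vertex K) []) (delta []) (delta (root_vertex K))"
    by (auto simp: agree_along_def attach_def delta.rep_eq)
  from agree_along_poly_eval[OF K(1,2) H copies[OF Nil_W] this, of p] K(3) show ?thesis
    by (auto simp: agree_along_def vector_state_coord attach_def)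
qed

lemma spectral_distribution_copy:
  "distribution (unit_op (verts H)) (vector_state []) (adjacency H) = spectral_distribution K"
  unfolding distribution_def spectral_distribution_def vector_state_poly_eval_copy ..

text \<open>On the copy based at \<open>w\<close>, the vector \<open>f\<close> is a multiple of the
  point mass at the root of the copy, because every other vertex there begins with color
  \<open>i\<close>. The copy is invariant and \<open>a\<close> is centred, so the image vanishes at
  that root, and only words with a new letter in front of \<open>w\<close> survive.\<close>

lemma centred_extends_support:
  assumes a: "a \<in> generated_algebra (unit_op (verts H)) (adjacency H)" "vector_state [] a = 0"
    and f: "\<And>x. coord f x \<noteq> 0 \<Longrightarrow> map letter_color x = cs" and cs: "cs = [] \<or> hd cs \<noteq> i"
    and x: "coord (bop_apply a f) x \<noteq> 0"
  shows "map letter_color x = i # cs"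
proof -
  let ?r = "root_vertex K" and ?u = "unit_op (verts H)"
  obtain p where p: "a = poly_eval ?u p (adjacency H)"
    using a(1) by (auto simp: generated_algebra_def)
  let ?b = "poly_eval (unit_op (verts K)) p (adjacency K)"
  \<comment> \<open>The unit projects onto the vertices of \<open>H\<close>; hence \<open>x\<close>
    is a vertex and lies in one of the copies.\<close>
  have "?u * a = a"
    using generated_algebra_closed[OF unit_op_idem adjacency_unit_op[OF H]] a(1)
    unfolding closed_subalgebra_def by blast
  then have "coord (bop_apply a f) x = (if x \<in> verts H then coord (bop_apply a f) x else 0)"
    by (metis bop_apply_simps(2) coord_unit_op)
  then have "x \<in> verts H" using x by presburger
  then obtain w v where w: "w \<in> W" and v: "v \<in> verts K" and xw: "x = attach emb ?r w v"
    using cover by blast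
  have "agree_along K (attach emb ?r w) f (cscale (coord f w) (delta ?r))"
    unfolding agree_along_def
  proof
    fix y assume "y \<in> verts K"
    have "coord f (emb y # w) = 0"
    proof (rule ccontr)
      assume "coord f (emb y # w) \<noteq> 0"
      then have "i # map letter_color w = cs"
        using f[of "emb y # w"] by (simp add: emb_color)
      with cs show False by auto
    qed
    then show "coord f (attach emb ?r w y) = coord (cscale (coord f w) (delta ?r)) y"
      by (simp add: attach_def coord_cscale delta.rep_eq)
  qed
  from agree_along_poly_eval[OF K(1,2) H copies[OF w] this, of p] v
  have x_eq: "coord (bop_apply a f) x = coord f w * coord (bop_apply ?b (delta ?r)) v"
    by (simp add: agree_along_def p xw bop_apply_cscale coord_cscale)
  have "coord (bop_apply ?b (delta ?r)) ?r = 0"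
    using a(2) vector_state_poly_eval_copy[of p] by (simp add: p flip: vector_state_coord)
  with x x_eq have "v \<noteq> ?r" "coord f w \<noteq> 0" by auto
  then show ?thesis using f[of w] by (simp add: xw attach_def emb_color)
qed

end


section \<open>The two tilings of the free product\<close>

text \<open>The words at which a copy of the graph of color \<open>i\<close> is based.\<close>

definition fp_base :: "('v, 'e) rgraph \<Rightarrow> ('w, 'd) rgraph \<Rightarrow> color \<Rightarrow> ('v, 'w) word set" where
  "fp_base G1 G2 i = {w \<in> fp_verts G1 G2. w \<noteq> [] \<longrightarrow> letter_color (hd w) \<noteq> i}"

text \<open>A word beginning with a letter from \<open>emb\<close> is a non-root vertex of the copy
  based at its tail; any other word is a base itself. So distinct copies are disjoint.\<close>

lemma attach_eq_iff:
  assumes "w = [] \<or> hd w \<notin> range emb" "w' = [] \<or> hd w' \<notin> range emb" "inj emb"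
  shows "attach emb e w v = attach emb e w' v' \<longleftrightarrow> w = w' \<and> v = v'"
  using assms by (auto simp: attach_def inj_eq)

text \<open>Copies with different bases share no vertex, so an edge with an endpoint in the copy at
  \<open>w\<close> must carry the tag \<open>w\<close>: the edges there are exactly the tagged edges
  of \<open>K\<close>.\<close>

lemma copy_of_attach:
  fixes emb :: "'x \<Rightarrow> 'v + 'w" and eb :: "'b \<Rightarrow> 'c"
  assumes K: "multigraph K" and emb: "inj emb" and eb: "inj eb"
    and W: "\<And>w. w \<in> W \<Longrightarrow> w = [] \<or> hd w \<notin> range emb"
    and E: "edges H = {(w, eb \<beta>) |w \<beta>. w \<in> W \<and> \<beta> \<in> edges K}"
    and ends: "\<And>w \<beta>. ends H (w, eb \<beta>) = attach emb e w ` ends K \<beta>"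
    and V: "\<And>w v. w \<in> W \<Longrightarrow> v \<in> verts K \<Longrightarrow> attach emb e w v \<in> verts H"
    and w: "w \<in> W"
  shows "copy_of K H (attach emb e w)"
proof -
  let ?j = "attach emb e w"
  have inj: "inj ?j"
    using attach_eq_iff[OF W[OF w] W[OF w] emb] by (auto simp: inj_def)
  have same: "w' = w" if "\<beta> \<in> edges K" "w' \<in> W" "attach emb e w' ` ends K \<beta> = {?j v, y}" for w' \<beta> v y
  proof -
    have "?j v \<in> attach emb e w' ` ends K \<beta>" using that(3) by blast
    then show ?thesis using attach_eq_iff[OF W[OF w] W[OF that(2)] emb] by blast
  qed
  have join: "joining H (?j v) y = (\<lambda>\<beta>. (w, eb \<beta>)) ` {\<beta> \<in> edges K. ?j ` ends K \<beta> = {?j v, y}}" for v y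
  proof (intro set_eqI iffI)
    fix b assume "b \<in> joining H (?j v) y"
    then obtain w' \<beta> where b: "b = (w', eb \<beta>)" "w' \<in> W" "\<beta> \<in> edges K"
      "attach emb e w' ` ends K \<beta> = {?j v, y}"
      by (auto simp: joining_def E ends)
    moreover have "w' = w" using same b by blast
    ultimately show "b \<in> (\<lambda>\<beta>. (w, eb \<beta>)) ` {\<beta> \<in> edges K. ?j ` ends K \<beta> = {?j v, y}}" by blast
  qed (use w in \<open>auto simp: joining_def E ends\<close>)
  have joinV: "joining H (?j v) (?j v') = (\<lambda>\<beta>. (w, eb \<beta>)) ` joining K v v'" for v v'
  proof -
    have "?j ` ends K \<beta> = {?j v, ?j v'} \<longleftrightarrow> ends K \<beta> = {v, v'}" for \<beta>
      using inj_image_eq_iff[OF inj, of "ends K \<beta>" "{v, v'}"] by simp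
    then show ?thesis unfolding join by (simp add: joining_def)
  qed
  have "neighbours H (?j v) \<subseteq> ?j ` verts K" for v
  proof
    fix y assume "y \<in> neighbours H (?j v)"
    then obtain \<beta> where \<beta>: "\<beta> \<in> edges K" "?j ` ends K \<beta> = {?j v, y}"
      by (auto simp: neighbours_def join)
    moreover have "ends K \<beta> \<subseteq> verts K"
      using K \<beta>(1) by (auto simp: multigraph_def)
    ultimately show "y \<in> ?j ` verts K" by blast
  qed
  moreover have "card (joining H (?j v) (?j v')) = card (joining K v v')" for v v'
    unfolding joinV by (intro card_image inj_onI) (use eb in \<open>auto dest: injD\<close>)
  moreover have "inj_on ?j (verts K)" using inj by (rule inj_on_subset) simp
  ultimately show ?thesis
    unfolding copy_of_def using V[OF w] by blast
qed

section \<open>The two color operators of the free product\<close>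

context
  fixes G1 :: "('v, 'e) rgraph" and G2 :: "('w, 'd) rgraph"
  assumes G1: "rooted_graph G1" and G2: "rooted_graph G2"
begin

lemma rooted_graph_parts:
  "multigraph G1" "bounded_degrees G1" "root_vertex G1 \<in> verts G1"
  "multigraph G2" "bounded_degrees G2" "root_vertex G2 \<in> verts G2"
  using G1 G2 by (auto simp: rooted_graph_def)

abbreviation (input) "FP \<equiv> free_product G1 G2"
abbreviation (input) "FP_color i \<equiv> color_subgraph FP natural_color i"
abbreviation (input) "FP_op i \<equiv> adjacency (FP_color i)"
abbreviation (input) "FP_unit \<equiv> unit_op (fp_verts G1 G2)"
abbreviation (input) "FP_state \<equiv> vector_state ([] :: ('v, 'w) word)"

lemma verts_FP_color: "verts (FP_color i) = fp_verts G1 G2"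
  by (simp add: color_subgraph_def free_product_def)

lemma FP_color_wf: "multigraph (FP_color i)" "bounded_degrees (FP_color i)"
  using color_subgraph_wf multigraph_free_product[OF G1 G2] bounded_degrees_free_product[OF G1 G2]
  by blast+

lemma Nil_in_fp_base: "[] \<in> fp_base G1 G2 i"
  by (simp add: fp_base_def fp_verts_def)

lemma FP_edges1: "edges (FP_color Color1) = {(w, Inl \<beta>) |w \<beta>. w \<in> fp_base G1 G2 Color1 \<and> \<beta> \<in> edges G1}"
  by (auto simp: color_subgraph_def free_product_def fp_base_def)

lemma FP_edges2: "edges (FP_color Color2) = {(w, Inr \<beta>) |w \<beta>. w \<in> fp_base G1 G2 Color2 \<and> \<beta> \<in> edges G2}"
  by (auto simp: color_subgraph_def free_product_def fp_base_def)

lemma FP_ends: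
  "ends (FP_color i) (w, Inl \<beta>) = attach Inl (root_vertex G1) w ` ends G1 \<beta>"
  "ends (FP_color i) (w, Inr \<gamma>) = attach Inr (root_vertex G2) w ` ends G2 \<gamma>"
  by (simp_all add: color_subgraph_def free_product_def)

lemma attach_in_fp_verts:
  "w \<in> fp_base G1 G2 Color1 \<Longrightarrow> v \<in> verts G1 \<Longrightarrow> attach Inl (root_vertex G1) w v \<in> fp_verts G1 G2"
  "w \<in> fp_base G1 G2 Color2 \<Longrightarrow> v' \<in> verts G2 \<Longrightarrow> attach Inr (root_vertex G2) w v' \<in> fp_verts G1 G2"
  by (cases w; auto simp: attach_def fp_base_def fp_verts_def)+

lemma FP_copies1:
  assumes "w \<in> fp_base G1 G2 Color1"
  shows "copy_of G1 (FP_color Color1) (attach Inl (root_vertex G1) w)"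
  by (rule copy_of_attach[OF rooted_graph_parts(1) inj_Inl inj_Inl _ FP_edges1 FP_ends(1) _ assms])
    (auto simp: fp_base_def verts_FP_color attach_in_fp_verts)

lemma FP_copies2:
  assumes "w \<in> fp_base G1 G2 Color2"
  shows "copy_of G2 (FP_color Color2) (attach Inr (root_vertex G2) w)"
  by (rule copy_of_attach[OF rooted_graph_parts(4) inj_Inr inj_Inr _ FP_edges2 FP_ends(2) _ assms])
    (auto simp: fp_base_def verts_FP_color attach_in_fp_verts)

text \<open>A word beginning with color 1 lies in the copy based at its tail; any other word is the
  root of the copy based at itself.\<close>

lemma FP_cover1:
  assumes x: "x \<in> verts (FP_color Color1)"
  shows "\<exists>w\<in>fp_base G1 G2 Color1. \<exists>v\<in>verts G1. x = attach Inl (root_vertex G1) w v"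
proof (cases "x \<in> fp_base G1 G2 Color1")
  case True
  then show ?thesis
    using rooted_graph_parts(3) by (intro bexI[of _ x] bexI[of _ "root_vertex G1"]) (auto simp: attach_def)
next
  case False
  then obtain a w where "x = a # w" "letter_color a = Color1"
    using x by (cases x) (auto simp: fp_base_def verts_FP_color)
  then obtain v where v: "x = Inl v # w" by (cases a) auto
  then show ?thesis
    using x by (intro bexI[of _ w] bexI[of _ v])
      (auto simp: verts_FP_color attach_def fp_base_def fp_verts_def distinct_adj_Cons hd_map)
qed

lemma FP_cover2:
  assumes x: "x \<in> verts (FP_color Color2)"
  shows "\<exists>w\<in>fp_base G1 G2 Color2. \<exists>v\<in>verts G2. x = attach Inr (root_vertex G2) w v"
proof (cases "x \<in> fp_base G1 G2 Color2")
  case True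
  then show ?thesis
    using rooted_graph_parts(6) by (intro bexI[of _ x] bexI[of _ "root_vertex G2"]) (auto simp: attach_def)
next
  case False
  then obtain a w where "x = a # w" "letter_color a = Color2"
    using x by (cases x) (auto simp: fp_base_def verts_FP_color)
  then obtain v where v: "x = Inr v # w" by (cases a) auto
  then show ?thesis
    using x by (intro bexI[of _ w] bexI[of _ v])
      (auto simp: verts_FP_color attach_def fp_base_def fp_verts_def distinct_adj_Cons hd_map)
qed

lemmas FP_tiling1 = rooted_graph_parts(1-3) FP_color_wf[of Color1] Nil_in_fp_base FP_copies1 FP_cover1
  letter_color.simps(1)
lemmas FP_tiling2 = rooted_graph_parts(4-6) FP_color_wf[of Color2] Nil_in_fp_base FP_copies2 FP_cover2
  letter_color.simps(2)

lemma distribution_FP_op: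
  "distribution FP_unit FP_state (FP_op Color1) = spectral_distribution G1"
  "distribution FP_unit FP_state (FP_op Color2) = spectral_distribution G2"
  using spectral_distribution_copy[OF FP_tiling1] spectral_distribution_copy[OF FP_tiling2]
  by (simp_all add: verts_FP_color)

lemma FP_centred_extends_support:
  assumes "a \<in> generated_algebra FP_unit (FP_op i)" "FP_state a = 0"
    and "\<And>x. coord f x \<noteq> 0 \<Longrightarrow> map letter_color x = cs" "cs = [] \<or> hd cs \<noteq> i"
    and "coord (bop_apply a f) x \<noteq> 0"
  shows "map letter_color x = i # cs"
  using assms centred_extends_support[OF FP_tiling1, of a f cs x]
    centred_extends_support[OF FP_tiling2, of a f cs x]
  by (cases i) (simp_all add: verts_FP_color)

lemma FP_unit_simps:
  "FP_unit * FP_unit = FP_unit" "FP_unit * FP_op i = FP_op i" "FP_op i * FP_unit = FP_op i"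
  using unit_op_idem adjacency_unit_op[OF FP_color_wf, of i] by (simp_all add: verts_FP_color)

lemma FP_free: "free_pair FP_unit FP_state (FP_op Color1) (FP_op Color2)"
  unfolding free_pair_def free_subalgebras_def
proof (intro allI impI)
  let ?A = "case_color (generated_algebra FP_unit (FP_op Color1)) (generated_algebra FP_unit (FP_op Color2))"
  have A: "?A i = generated_algebra FP_unit (FP_op i)" for i by (cases i) simp_all
  fix "is" :: "color list" and as :: "('v, 'w) word bop list"
  assume *: "is \<noteq> [] \<and> length as = length is \<and> distinct_adj is \<and>
    (\<forall>j<length is. as ! j \<in> ?A (is ! j) \<and> FP_state (as ! j) = 0)"
  then have "length as = length is" "distinct_adj is"
    "\<forall>j<length is. as ! j \<in> ?A (is ! j) \<and> FP_state (as ! j) = 0"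
    by blast+
  \<comment> \<open>Stronger than the goal: the image of the root vector is supported on words with
    color sequence exactly \<open>is\<close>. As \<open>is\<close> is nonempty, the coordinate at
    the root vanishes.\<close>
  then have "map letter_color x = is"
    if "coord (bop_apply (foldr (*) as FP_unit) (delta [])) x \<noteq> 0" for x
    using that
  proof (induction as "is" arbitrary: x rule: list_induct2)
    case Nil
    then show ?case by (simp add: coord_unit_op delta.rep_eq split: if_splits)
  next
    case (Cons a as i "is")
    have 0: "\<forall>j<length is. as ! j \<in> ?A (is ! j) \<and> FP_state (as ! j) = 0"
      using Cons.prems(2) by (metis Suc_mono length_Cons nth_Cons_Suc)
    have dist: "distinct_adj is" using Cons.prems(1) by (cases "is") auto
    show ?case
    proof (rule FP_centred_extends_support)
      show "a \<in> generated_algebra FP_unit (FP_op i)" "FP_state a = 0"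
        using Cons.prems(2)[rule_format, of 0] by (simp_all add: A)
      show "map letter_color y = is"
        if "coord (bop_apply (foldr (*) as FP_unit) (delta [])) y \<noteq> 0" for y
        using Cons.IH[OF dist 0 that] .
      show "is = [] \<or> hd is \<noteq> i" using Cons.prems(1) by (auto simp: distinct_adj_Cons)
      show "coord (bop_apply a (bop_apply (foldr (*) as FP_unit) (delta []))) x \<noteq> 0"
        using Cons.prems(3) by (simp add: bop_apply_simps)
    qed
  qed
  then show "FP_state (foldr (*) as FP_unit) = 0"
    using * by (auto simp: vector_state_coord)
qed

text \<open>Freeness is a property of the generated algebras, and subtracting the unit does not lead
  out of them.\<close>

lemma FP_free_shifted: "free_pair FP_unit FP_state (FP_op Color1 - FP_unit) (FP_op Color2 - FP_unit)"
proof -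
  have sub: "generated_algebra FP_unit (FP_op i - FP_unit) \<subseteq> generated_algebra FP_unit (FP_op i)" for i
  proof -
    have cl: "closed_subalgebra FP_unit (generated_algebra FP_unit (FP_op i))"
      by (rule generated_algebra_closed) (simp_all add: FP_unit_simps)
    then have "FP_unit \<in> generated_algebra FP_unit (FP_op i)"
      by (simp add: closed_subalgebra_def)
    then show ?thesis
      by (intro generated_algebra_subset[OF cl] closed_subalgebra_diff[OF cl]
          generator_in_generated_algebra FP_unit_simps)
  qed
  show ?thesis
    unfolding free_pair_def
    by (rule free_subalgebras_mono[OF FP_free[unfolded free_pair_def]])
      (use sub in \<open>simp split: color.split\<close>)
qed

lemma FP_mult_conv:
  "spectral_distribution G1 \<boxtimes> spectral_distribution G2 =
   distribution FP_unit FP_state (FP_op Color1 * FP_op Color2)"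
proof -
  have "unital_functional FP_unit FP_state"
    by (rule unital_functional_vector_state) (simp add: fp_verts_def)
  from free_mult_conv_distribution[OF FP_unit_simps(1) FP_unit_simps(2,3) FP_unit_simps(2,3) this FP_free]
  show ?thesis by (simp add: distribution_FP_op)
qed

end


section \<open>Counting walks by their colors\<close>

lemma is_walk_Nil: "is_walk G (vs, []) \<longleftrightarrow> (\<exists>v\<in>verts G. vs = [v])"
  by (auto simp: length_Suc_conv)

lemma is_walk_Cons:
  "is_walk G (x # vs, \<beta> # es) \<longleftrightarrow>
     x \<in> verts G \<and> \<beta> \<in> edges G \<and> ends G \<beta> = {x, hd vs} \<and> is_walk G (vs, es)"
  by (cases vs) (auto simp: All_less_Suc2)

lemma is_walk_nonempty: "is_walk G (vs, es) \<Longrightarrow> vs \<noteq> []"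
  by auto

lemma walk_hd_last:
  assumes "is_walk G (vs, es)"
  shows "hd vs = vs ! 0" "last vs = vs ! length es"
  using assms is_walk_nonempty[OF assms] by (simp_all add: last_conv_nth hd_conv_nth)

text \<open>Walks grouped by their exact color sequence: these are what the matrix entries of a
  product of color operators count.\<close>

definition colored_walks ::
    "('v, 'e) rgraph \<Rightarrow> ('e \<Rightarrow> color) \<Rightarrow> color list \<Rightarrow> 'v \<Rightarrow> 'v \<Rightarrow> ('v, 'e) walk set" where
  "colored_walks G c l x y =
     {(vs, es). is_walk G (vs, es) \<and> map c es = l \<and> hd vs = x \<and> last vs = y}"

lemma colored_walks_Nil:
  "colored_walks G c [] x y = (if x = y \<and> x \<in> verts G then {([x], [])} else {})"
  by (auto simp: colored_walks_def is_walk_Nil simp del: is_walk.simps)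

text \<open>Choosing the neighbour \<open>x'\<close> first and the joining edge second matches the
  sum over neighbours in the adjacency operator.\<close>

lemma colored_walks_Cons:
  assumes "multigraph G"
  shows "colored_walks G c (i # l) x y =
    (\<Union>x'\<in>neighbours (color_subgraph G c i) x.
      (\<lambda>(\<beta>, vs, es). (x # vs, \<beta> # es)) `
        (joining (color_subgraph G c i) x x' \<times> colored_walks G c l x' y))"
    (is "?L = ?R")
proof (intro set_eqI iffI)
  fix p assume "p \<in> ?L"
  then obtain vs0 es0 where p0: "p = (vs0, es0)" "is_walk G (vs0, es0)" "map c es0 = i # l"
    "hd vs0 = x" "last vs0 = y"
    by (auto simp: colored_walks_def)
  obtain \<beta> es where es: "es0 = \<beta> # es" using p0(3) by auto
  obtain vs where vs: "vs0 = x # vs" using p0(2,4) is_walk_nonempty by (cases vs0) auto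
  have p: "p = (x # vs, \<beta> # es)" and walk: "is_walk G (x # vs, \<beta> # es)"
    and c: "c \<beta> = i" "map c es = l" and y: "last (x # vs) = y"
    using p0 by (simp_all add: es vs del: is_walk.simps)
  from walk have w: "\<beta> \<in> edges G" "ends G \<beta> = {x, hd vs}" "is_walk G (vs, es)"
    by (simp_all add: is_walk_Cons del: is_walk.simps)
  have "\<beta> \<in> joining (color_subgraph G c i) x (hd vs)"
    using w c by (simp add: joining_def color_subgraph_def)
  moreover have "(vs, es) \<in> colored_walks G c l (hd vs) y"
    using w(3) c(2) y is_walk_nonempty[OF w(3)] by (simp add: colored_walks_def del: is_walk.simps)
  ultimately show "p \<in> ?R"
    unfolding p by (force simp: neighbours_def)
next
  fix p assume "p \<in> ?R"
  then obtain x' \<beta> vs es where p: "p = (x # vs, \<beta> # es)"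
    and \<beta>: "\<beta> \<in> joining (color_subgraph G c i) x x'" and w: "(vs, es) \<in> colored_walks G c l x' y"
    by auto
  have "x \<in> verts G"
  proof -
    have "\<beta> \<in> edges G" "ends G \<beta> = {x, x'}" using \<beta> by (auto simp: joining_def color_subgraph_def)
    then show ?thesis
      using neighbours_verts(1)[OF assms, of x' x] by (auto simp: neighbours_def joining_def)
  qed
  then show "p \<in> ?L"
    using \<beta> w is_walk_nonempty[of G vs es]
    by (auto simp: p colored_walks_def is_walk_Cons joining_def color_subgraph_def simp del: is_walk.simps)
qed

text \<open>The leftmost factor is the first step from \<open>x\<close>, and \<open>delta y\<close>
  fixes the end, so the first-edge decomposition is the row expansion of the matrix product. The
  final \<open>unit_op\<close> accounts for the walk of length 0, which exists only at a vertex of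
  the graph.\<close>

lemma card_colored_walks:
  fixes G :: "('v, 'e) rgraph"
  assumes G: "multigraph G" "bounded_degrees G"
  shows "finite (colored_walks G c l x y)"
    and "of_nat (card (colored_walks G c l x y)) =
      coord (bop_apply (foldr (*) (map (\<lambda>i. adjacency (color_subgraph G c i)) l) (unit_op (verts G)))
        (delta y)) x"
proof -
  have "finite (colored_walks G c l x y) \<and> of_nat (card (colored_walks G c l x y)) =
      coord (bop_apply (foldr (*) (map (\<lambda>i. adjacency (color_subgraph G c i)) l) (unit_op (verts G)))
        (delta y)) x"
  proof (induction l arbitrary: x)
    case Nil
    show ?case
      by (simp add: colored_walks_Nil coord_unit_op delta.rep_eq)
  next
    case (Cons i l)
    let ?H = "color_subgraph G c i"
    let ?f = "\<lambda>(\<beta>, vs, es). (x # vs, \<beta> # es)"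
    let ?P = "\<lambda>x'. ?f ` (joining ?H x x' \<times> colored_walks G c l x' y)"
    note H = color_subgraph_wf[OF G, of c i]
    have N: "finite (neighbours ?H x)" "finite (joining ?H x x')" for x'
      using neighbours_bounded[OF H] by blast+
    have fin: "finite (?P x')" for x' using N Cons.IH by blast
    have card: "card (?P x') = card (joining ?H x x') * card (colored_walks G c l x' y)" for x'
      by (subst card_image) (auto simp: inj_on_def card_cartesian_product)
    \<comment> \<open>The second vertex of a walk in \<open>?P x'\<close> is
      \<open>x'\<close>.\<close>
    have disj: "?P x' \<inter> ?P x'' = {}" if "x' \<noteq> x''" for x' x''
      using that by (auto simp: colored_walks_def)
    have "card (\<Union>x'\<in>neighbours ?H x. ?P x') = (\<Sum>x'\<in>neighbours ?H x. card (?P x'))"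
      by (rule card_UN_disjoint) (use N fin disj in auto)
    then show ?case
      using N fin Cons.IH
      by (simp add: colored_walks_Cons[OF G(1)] card bop_apply_simps coord_adjacency[OF H])
  qed
  then show "finite (colored_walks G c l x y)"
    and "of_nat (card (colored_walks G c l x y)) =
      coord (bop_apply (foldr (*) (map (\<lambda>i. adjacency (color_subgraph G c i)) l) (unit_op (verts G)))
        (delta y)) x" by auto
qed

lemma is_walk_rev:
  assumes "is_walk G (vs, es)"
  shows "is_walk G (rev vs, rev es)"
proof -
  have "ends G (rev es ! i) = {rev vs ! i, rev vs ! Suc i}" "rev es ! i \<in> edges G"
    if i: "i < length es" for i
  proof -
    let ?j = "length es - Suc i"
    have "?j < length es" "rev es ! i = es ! ?j" "rev vs ! i = vs ! Suc ?j" "rev vs ! Suc i = vs ! ?j"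
      using assms i by (auto simp: rev_nth Suc_diff_Suc)
    then show "ends G (rev es ! i) = {rev vs ! i, rev vs ! Suc i}" "rev es ! i \<in> edges G"
      using assms by auto
  qed
  then show ?thesis using assms by simp
qed

text \<open>Reversing a walk is an involution exchanging the two sets. It turns counts for
  \<open>S2 * S1\<close> into counts for \<open>S1 * S2\<close>.\<close>

lemma card_colored_walks_rev:
  "card (colored_walks G c (rev l) y x) = card (colored_walks G c l x y)"
proof -
  have mem: "(rev vs, rev es) \<in> colored_walks G c (rev l) y x"
    if "(vs, es) \<in> colored_walks G c l x y" for vs es l x y
  proof -
    have "vs \<noteq> []" "is_walk G (vs, es)" using that by (auto simp: colored_walks_def)
    then show ?thesis
      using that is_walk_rev[of G vs es]
      by (auto simp: colored_walks_def hd_rev last_rev rev_map simp del: is_walk.simps)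
  qed
  have "bij_betw (\<lambda>(vs, es). (rev vs, rev es)) (colored_walks G c l x y) (colored_walks G c (rev l) y x)"
  proof (rule bij_betw_byWitness[where f' = "\<lambda>(vs, es). (rev vs, rev es)"])
    show "(\<lambda>(vs, es). (rev vs, rev es)) ` colored_walks G c l x y \<subseteq> colored_walks G c (rev l) y x"
      by (rule image_subsetI, clarify) (rule mem)
    show "(\<lambda>(vs, es). (rev vs, rev es)) ` colored_walks G c (rev l) y x \<subseteq> colored_walks G c l x y"
    proof (rule image_subsetI, clarify)
      fix vs es assume "(vs, es) \<in> colored_walks G c (rev l) y x"
      from mem[OF this] show "(rev vs, rev es) \<in> colored_walks G c l x y" by (simp only: rev_rev_ident)
    qed
  qed auto
  then show ?thesis by (simp add: bij_betw_same_card)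
qed

section \<open>The alternating color pattern and the moments it describes\<close>

definition alternating_colors :: "nat \<Rightarrow> color list" where
  "alternating_colors n = concat (replicate n [Color1, Color2])"

lemma length_alternating_colors [simp]: "length (alternating_colors n) = 2 * n"
  by (induction n) (simp_all add: alternating_colors_def)

lemma nth_alternating_colors:
  "i < 2 * n \<Longrightarrow> alternating_colors n ! i = (if even i then Color1 else Color2)"
proof (induction n arbitrary: i)
  case (Suc n)
  show ?case
  proof (cases "i < 2")
    case True
    then show ?thesis by (auto simp: alternating_colors_def less_2_cases_iff)
  next
    case False
    then obtain j where "i = Suc (Suc j)" by (metis One_nat_def Suc_1 Suc_le_D Suc_le_mono not_less)
    with Suc show ?thesis by (simp add: alternating_colors_def)
  qed
qed simp

text \<open>With only two colors, each entry is forced by the one before it, hence by the parity of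
  its position.\<close>

lemma eq_alternating_colors:
  assumes "distinct_adj l" "length l = 2 * n" "l \<noteq> []" "hd l = Color1"
  shows "l = alternating_colors n"
proof (rule nth_equalityI)
  fix i assume "i < length l"
  then have "l ! i = (if even i then Color1 else Color2)"
  proof (induction i)
    case 0
    then show ?case using assms(3,4) by (simp add: hd_conv_nth)
  next
    case (Suc i)
    then have "l ! Suc i \<noteq> l ! i" using assms(1) by (metis distinct_adj_conv_nth)
    with Suc show ?case by (cases "l ! Suc i") (auto split: if_splits)
  qed
  then show "l ! i = alternating_colors n ! i"
    using \<open>i < length l\<close> assms(2) by (simp add: nth_alternating_colors)
qed (simp add: assms(2))

lemma distinct_adj_alternating_colors: "distinct_adj (alternating_colors n)"
  by (auto simp: distinct_adj_conv_nth nth_alternating_colors)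

lemma moment_alternating_product:
  fixes c
  assumes G: "multigraph G" "bounded_degrees G"
  defines "S \<equiv> \<lambda>i. adjacency (color_subgraph G c i)"
  shows "vector_state e (unital_power (unit_op (verts G)) (S Color1 * S Color2) n) =
      of_nat (card (colored_walks G c (alternating_colors n) e e))" (is ?th1)
    and "vector_state e (unital_power (unit_op (verts G)) (S Color2 * S Color1) n) =
      of_nat (card (colored_walks G c (alternating_colors n) e e))" (is ?th2)
proof -
  have power: "unital_power u (S i * S j) n = foldr (*) (map S (concat (replicate n [i, j]))) u" for u i j
    by (induction n) (simp_all add: mult.assoc)
  note card = card_colored_walks(2)[OF G, of c, folded S_def]
  show ?th1
    by (simp add: vector_state_coord power card alternating_colors_def)
  \<comment> \<open>The pattern of a power of \<open>S2 * S1\<close> is that of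
    \<open>S1 * S2\<close> read backwards, and a reversed closed walk is closed at the same
    vertex.\<close>
  have "concat (replicate n [Color2, Color1]) = rev (alternating_colors n)"
    by (simp add: alternating_colors_def rev_concat)
  then have "card (colored_walks G c (concat (replicate n [Color2, Color1])) e e) =
      card (colored_walks G c (alternating_colors n) e e)"
    by (simp only: card_colored_walks_rev)
  then show ?th2
    using card[of "concat (replicate n [Color2, Color1])" e e]
    by (simp add: vector_state_coord power)
qed


section \<open>Renewal at the second return\<close>

lemma is_walk_take:
  "is_walk G (vs, es) \<Longrightarrow> k \<le> length es \<Longrightarrow> is_walk G (take (Suc k) vs, take k es)"
  by (auto dest: in_set_takeD)

lemma is_walk_drop:
  "is_walk G (vs, es) \<Longrightarrow> k \<le> length es \<Longrightarrow> is_walk G (drop k vs, drop k es)"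
  by (auto simp: add_ac dest: in_set_dropD)

lemma concat_walk_take_drop:
  "concat_walk (take (Suc k) vs, take k es) (drop k vs, drop k es) = (vs, es)"
proof -
  have "tl (drop k vs) = drop (Suc k) vs" by (simp add: drop_Suc tl_drop)
  then show ?thesis by (simp only: concat_walk.simps append_take_drop_id)
qed

text \<open>\<open>tl v2\<close> drops the repeated junction vertex. At the junction both formulas
  apply, and \<open>last v1 = hd v2\<close> makes them agree.\<close>

lemma nth_concat_walk:
  assumes "is_walk G (v1, e1)" "is_walk G (v2, e2)" "last v1 = hd v2"
  shows "i \<le> length e1 \<Longrightarrow> (v1 @ tl v2) ! i = v1 ! i"
    and "i \<le> length e2 \<Longrightarrow> (v1 @ tl v2) ! (length e1 + i) = v2 ! i"
proof -
  show "(v1 @ tl v2) ! i = v1 ! i" if "i \<le> length e1"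
    using assms(1) that by (simp add: nth_append)
  show "(v1 @ tl v2) ! (length e1 + i) = v2 ! i" if "i \<le> length e2"
  proof (cases i)
    case 0
    then show ?thesis
      using assms(1,3) walk_hd_last[OF assms(1)] walk_hd_last[OF assms(2)] by (simp add: nth_append)
  next
    case (Suc j)
    then show ?thesis
      using assms(1,2) that by (simp add: nth_append nth_tl)
  qed
qed

lemma is_walk_concat:
  assumes w: "is_walk G (v1, e1)" "is_walk G (v2, e2)" "last v1 = hd v2"
  shows "is_walk G (concat_walk (v1, e1) (v2, e2))"
proof -
  have "(e1 @ e2) ! i \<in> edges G \<and>
      ends G ((e1 @ e2) ! i) = {(v1 @ tl v2) ! i, (v1 @ tl v2) ! Suc i}"
    if i: "i < length (e1 @ e2)" for i
  proof (cases "i < length e1")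
    case True
    then show ?thesis
      using w(1) nth_concat_walk(1)[OF w, of i] nth_concat_walk(1)[OF w, of "Suc i"]
      by (simp add: nth_append)
  next
    case False
    then obtain j where "i = length e1 + j" "j < length e2"
      using i by (metis le_Suc_ex length_append nat_add_left_cancel_less not_less)
    then show ?thesis
      using w(2) nth_concat_walk(2)[OF w, of j] nth_concat_walk(2)[OF w, of "Suc j"]
      by (simp add: nth_append)
  qed
  moreover have "set (v1 @ tl v2) \<subseteq> verts G"
    using w(1,2) by (auto dest: list.set_sel(2)[rotated])
  ultimately show ?thesis
    using w(1,2) by simp
qed

lemma alternating_colors_add: "alternating_colors (m + n) = alternating_colors m @ alternating_colors n"
  by (simp add: alternating_colors_def replicate_add)

lemma alternating_colors_split:
  assumes "k \<le> n"
  shows "take (2 * k) (alternating_colors n) = alternating_colors k"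
    and "drop (2 * k) (alternating_colors n) = alternating_colors (n - k)"
  using alternating_colors_add[of k "n - k"] assms by simp_all

section \<open>Closed alternating walks at a vertex and their returns\<close>

context
  fixes G :: "('v, 'e) rgraph" and c :: "'e \<Rightarrow> color" and e :: 'v
begin

abbreviation (input) "closed_walks n \<equiv> colored_walks G c (alternating_colors n) e e"
abbreviation (input) "d_walks n \<equiv> alternating_d_walks G c e (2 * n)"

lemma closed_walks_iff:
  "(vs, es) \<in> closed_walks n \<longleftrightarrow>
     is_walk G (vs, es) \<and> map c es = alternating_colors n \<and> length es = 2 * n \<and>
     vs ! 0 = e \<and> vs ! (2 * n) = e"
proof -
  have "length es = 2 * n" if "map c es = alternating_colors n"
    using arg_cong[OF that, of length] by simp
  then show ?thesis
    by (auto simp: colored_walks_def walk_hd_last simp del: is_walk.simps)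
qed

text \<open>The junction of the two f-walks is the only interior visit to \<open>e\<close>;
  conversely, cutting at that visit gives two f-walks. The renewal argument works with such visiting
  times instead of pairs of walks.\<close>

lemma d_walks_iff:
  "(vs, es) \<in> d_walks n \<longleftrightarrow> (vs, es) \<in> closed_walks n \<and>
     (\<exists>t. 0 < t \<and> t < 2 * n \<and> vs ! t = e \<and> (\<forall>i. 0 < i \<and> i < 2 * n \<and> i \<noteq> t \<longrightarrow> vs ! i \<noteq> e))"
proof
  assume "(vs, es) \<in> d_walks n"
  then obtain u1 u2 where w: "is_walk G (vs, es)" "length es = 2 * n" "distinct_adj (map c es)"
    "es \<noteq> []" "c (hd es) = Color1" and u: "is_f_walk G e u1" "is_f_walk G e u2"
      "(vs, es) = concat_walk u1 u2"
    unfolding alternating_d_walks_def by blast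
  obtain v1 e1 v2 e2 where "u1 = (v1, e1)" "u2 = (v2, e2)" by (cases u1, cases u2)
  with u have f: "is_f_walk G e (v1, e1)" "is_f_walk G e (v2, e2)"
    and vs: "vs = v1 @ tl v2" and es: "es = e1 @ e2"
    by (simp_all del: is_f_walk.simps)
  have w12: "is_walk G (v1, e1)" "is_walk G (v2, e2)" "last v1 = hd v2" and "e1 \<noteq> []" "e2 \<noteq> []"
    and ends: "v1 ! 0 = e" "v1 ! length e1 = e" "v2 ! length e2 = e"
    and inner: "\<And>i. 1 \<le> i \<Longrightarrow> i < length e1 \<Longrightarrow> v1 ! i \<noteq> e" "\<And>i. 1 \<le> i \<Longrightarrow> i < length e2 \<Longrightarrow> v2 ! i \<noteq> e"
    using f walk_hd_last[of G v1 e1] walk_hd_last[of G v2 e2] by (simp_all del: is_walk.simps)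
  note nth = nth_concat_walk[OF w12, folded vs]
  have len: "length e1 + length e2 = 2 * n" using w(2) es by simp
  have "map c es = alternating_colors n"
    by (rule eq_alternating_colors) (use w in \<open>simp_all add: hd_map\<close>)
  moreover have "vs ! 0 = e" "vs ! (2 * n) = e"
    using nth(1)[of 0] nth(2)[of "length e2"] ends len by simp_all
  moreover have "vs ! length e1 = e" using nth(1)[of "length e1"] ends by simp
  moreover have "vs ! i \<noteq> e" if "0 < i" "i < 2 * n" "i \<noteq> length e1" for i
  proof (cases "i < length e1")
    case True
    then show ?thesis using nth(1)[of i] inner(1)[of i] that by simp
  next
    case False
    then obtain j where "i = length e1 + j" by (metis le_Suc_ex not_less)
    then show ?thesis using nth(2)[of j] inner(2)[of j] that len by simp
  qed
  moreover have "0 < length e1" "length e1 < 2 * n" using \<open>e1 \<noteq> []\<close> \<open>e2 \<noteq> []\<close> len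
    unfolding length_greater_0_conv[symmetric] by linarith+
  ultimately show "(vs, es) \<in> closed_walks n \<and>
      (\<exists>t. 0 < t \<and> t < 2 * n \<and> vs ! t = e \<and> (\<forall>i. 0 < i \<and> i < 2 * n \<and> i \<noteq> t \<longrightarrow> vs ! i \<noteq> e))"
    using w(1,2) unfolding closed_walks_iff by blast
next
  assume "(vs, es) \<in> closed_walks n \<and>
      (\<exists>t. 0 < t \<and> t < 2 * n \<and> vs ! t = e \<and> (\<forall>i. 0 < i \<and> i < 2 * n \<and> i \<noteq> t \<longrightarrow> vs ! i \<noteq> e))"
  then obtain t where w: "is_walk G (vs, es)" "map c es = alternating_colors n" "length es = 2 * n"
      "vs ! 0 = e" "vs ! (2 * n) = e"
    and t: "0 < t" "t < 2 * n" "vs ! t = e" "\<And>i. 0 < i \<Longrightarrow> i < 2 * n \<Longrightarrow> i \<noteq> t \<Longrightarrow> vs ! i \<noteq> e"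
    unfolding closed_walks_iff by blast
  have len: "length vs = Suc (2 * n)" using w(1,3) by simp
  let ?u1 = "(take (Suc t) vs, take t es)" and ?u2 = "(drop t vs, drop t es)"
  have tw: "is_walk G ?u1" "is_walk G ?u2"
    using is_walk_take[OF w(1), of t] is_walk_drop[OF w(1), of t] t w(3)
    by (simp_all del: is_walk.simps)
  have "es \<noteq> []" using t w(3) by auto
  have f1: "is_f_walk G e ?u1"
    using \<open>es \<noteq> []\<close> tw(1) t w len walk_hd_last[OF tw(1)] by (simp del: is_walk.simps)
  have late: "vs ! (t + i) \<noteq> e" if "Suc 0 \<le> i" "i < 2 * n - t" for i
    by (rule t(4)) (use that t(1) in auto)
  have "is_f_walk G e ?u2"
    using late tw(2) t(1-3) w len walk_hd_last[OF tw(2)] by (simp del: is_walk.simps)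
  with f1 have "\<exists>u1 u2. is_f_walk G e u1 \<and> is_f_walk G e u2 \<and> (vs, es) = concat_walk u1 u2"
    using concat_walk_take_drop[symmetric] by blast
  moreover have "c (hd es) = Color1"
  proof -
    have "c (hd es) = map c es ! 0" using \<open>es \<noteq> []\<close> by (simp add: hd_conv_nth)
    also have "\<dots> = Color1" unfolding w(2) using t by (subst nth_alternating_colors) auto
    finally show ?thesis .
  qed
  ultimately show "(vs, es) \<in> d_walks n"
    using w(1-3) distinct_adj_alternating_colors[of n] \<open>es \<noteq> []\<close>
    by (simp add: alternating_d_walks_def del: is_walk.simps)
qed

text \<open>The length \<open>2 * k\<close> of the first piece is fixed, so both pieces can be read
  off the concatenation; injectivity of gluing follows from this.\<close>

lemma concat_d_walk_closed_walk:
  assumes "k \<le> n" "p \<in> d_walks k" "q \<in> closed_walks (n - k)"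
  shows "concat_walk p q \<in> closed_walks n"
    and "\<And>vs es. concat_walk p q = (vs, es) \<Longrightarrow> p = (take (Suc (2 * k)) vs, take (2 * k) es)
      \<and> q = (drop (2 * k) vs, drop (2 * k) es)"
proof -
  obtain v1 e1 v2 e2 where pq: "p = (v1, e1)" "q = (v2, e2)" by (cases p, cases q)
  have p: "is_walk G (v1, e1)" "map c e1 = alternating_colors k" "length e1 = 2 * k"
      "v1 ! 0 = e" "v1 ! (2 * k) = e"
    and q: "is_walk G (v2, e2)" "map c e2 = alternating_colors (n - k)" "length e2 = 2 * (n - k)"
      "v2 ! 0 = e" "v2 ! (2 * (n - k)) = e"
    using assms(2,3) unfolding pq d_walks_iff closed_walks_iff by auto
  have glue: "last v1 = hd v2"
    using walk_hd_last[OF p(1)] walk_hd_last[OF q(1)] p q by simp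
  note nth = nth_concat_walk[OF p(1) q(1) glue]
  have "(v1 @ tl v2) ! 0 = e" "(v1 @ tl v2) ! (2 * k + 2 * (n - k)) = e"
    using nth(1)[of 0] nth(2)[of "2 * (n - k)"] p q by simp_all
  moreover have "2 * k + 2 * (n - k) = 2 * n" using assms(1) by simp
  moreover have "map c (e1 @ e2) = alternating_colors n"
    using alternating_colors_add[of k "n - k"] p(2) q(2) assms(1) by simp
  ultimately show "concat_walk p q \<in> closed_walks n"
    using is_walk_concat[OF p(1) q(1) glue] p(3) q(3)
    unfolding pq concat_walk.simps closed_walks_iff by (simp only: length_append simp_thms)
  have "length v1 = Suc (2 * k)" using p(1,3) by simp
  moreover have "drop (2 * k) (v1 @ tl v2) = v2"
  proof -
    have "drop (2 * k) v1 = [last v1]"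
      using \<open>length v1 = Suc (2 * k)\<close>
      by (metis append_butlast_last_id append_eq_conv_conj diff_Suc_1 length_butlast list.size(3)
          nat.distinct(1))
    moreover have "v2 \<noteq> []" using q(1) by auto
    ultimately show ?thesis using \<open>length v1 = Suc (2 * k)\<close> glue by simp
  qed
  ultimately show "p = (take (Suc (2 * k)) vs, take (2 * k) es) \<and> q = (drop (2 * k) vs, drop (2 * k) es)"
    if "concat_walk p q = (vs, es)" for vs es
    using that p(3) unfolding pq by auto
qed

text \<open>By \<open>return\<close>, an excursion from \<open>e\<close> closes with the color it
  opened with. Colors follow the parity of the position, so each return flips the parity of the
  time: the first return is odd and the second is even, which is where the walk is cut.\<close>

lemma closed_walks_renewal:
  assumes return: "\<And>vs es s t. is_walk G (vs, es) \<Longrightarrow> s < t \<Longrightarrow> t \<le> length es \<Longrightarrow> vs ! s = e \<Longrightarrow> vs ! t = e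
      \<Longrightarrow> (\<And>i. s < i \<Longrightarrow> i < t \<Longrightarrow> vs ! i \<noteq> e) \<Longrightarrow> c (es ! (t - 1)) = c (es ! s)"
    and n: "1 \<le> n"
  shows "closed_walks n = (\<Union>k\<in>{1..n}. (\<lambda>(p, q). concat_walk p q) ` (d_walks k \<times> closed_walks (n - k)))"
    (is "_ = ?R")
proof (intro set_eqI iffI)
  fix w assume "w \<in> ?R"
  then show "w \<in> closed_walks n" using concat_d_walk_closed_walk(1) by fastforce
next
  fix w assume "w \<in> closed_walks n"
  then obtain vs es where wdef: "w = (vs, es)" and w: "is_walk G (vs, es)" "map c es = alternating_colors n"
    "length es = 2 * n" "vs ! 0 = e" "vs ! (2 * n) = e"
    by (cases w) (auto simp: closed_walks_iff simp del: is_walk.simps)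
  have col: "c (es ! i) = (if even i then Color1 else Color2)" if "i < 2 * n" for i
    using nth_map[of i es c] nth_alternating_colors[OF that] that w(2,3) by simp
  \<comment> \<open>The excursion uses the edges with indices from \<open>s\<close> to
    \<open>t - 1\<close>; equal colors at its two ends mean equal parity of these indices.\<close>
  have next_return: "\<exists>t>s. t \<le> 2 * n \<and> vs ! t = e \<and>
      (\<forall>i. s < i \<and> i < t \<longrightarrow> vs ! i \<noteq> e) \<and> even (t - 1) = even s"
    if s: "s < 2 * n" "vs ! s = e" for s
  proof -
    define t where "t = (LEAST t. s < t \<and> vs ! t = e)"
    have t: "s < t" "vs ! t = e"
      using LeastI[of "\<lambda>t. s < t \<and> vs ! t = e" "2 * n"] s w(5) by (auto simp: t_def)
    have t2: "t \<le> 2 * n"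
      unfolding t_def by (rule Least_le) (use s w(5) in auto)
    have first: "vs ! i \<noteq> e" if "s < i" "i < t" for i
      using not_less_Least[of i "\<lambda>t. s < t \<and> vs ! t = e"] that by (auto simp: t_def)
    have lt: "t - 1 < 2 * n" using t(1) t2 by linarith
    have "c (es ! (t - 1)) = c (es ! s)"
      using return[OF w(1) t(1) _ s(2) t(2) first] t2 w(3) by simp
    then have "even (t - 1) = even s"
      using col[OF lt] col[OF s(1)] by (simp split: if_splits)
    with t t2 first show ?thesis by blast
  qed
  obtain t where t: "0 < t" "t \<le> 2 * n" "vs ! t = e" "\<And>i. 0 < i \<Longrightarrow> i < t \<Longrightarrow> vs ! i \<noteq> e" "even (t - 1)"
    using next_return[of 0] n w(4) by auto
  \<comment> \<open>An odd first return cannot be the end \<open>2 * n\<close>, so a second return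
    exists.\<close>
  then have "odd t" by (cases t) auto
  then have "t < 2 * n" using t(2) by (cases "t = 2 * n") auto
  then obtain m where m: "t < m" "m \<le> 2 * n" "vs ! m = e"
    "\<And>i. t < i \<Longrightarrow> i < m \<Longrightarrow> vs ! i \<noteq> e" "even (m - 1) = even t"
    using next_return[of t] t(3) by auto
  then have "even m" using \<open>odd t\<close> by (cases m) auto
  then obtain k where k: "m = 2 * k" by (elim evenE)
  have kn: "k \<in> {1..n}" using k m(1,2) t(1) by auto
  have len: "length vs = Suc (2 * n)" using w(1,3) by simp
  have "(take (Suc (2 * k)) vs, take (2 * k) es) \<in> d_walks k"
    unfolding d_walks_iff closed_walks_iff
  proof (intro conjI exI[of _ t])
    show "is_walk G (take (Suc (2 * k)) vs, take (2 * k) es)"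
      by (rule is_walk_take[OF w(1)]) (use kn w(3) in simp)
    show "map c (take (2 * k) es) = alternating_colors k"
      using alternating_colors_split(1)[of k n] kn by (simp add: w(2) flip: take_map)
    show "\<forall>i. 0 < i \<and> i < 2 * k \<and> i \<noteq> t \<longrightarrow> take (Suc (2 * k)) vs ! i \<noteq> e"
      using t(4) m(4) k by (metis less_Suc_eq linorder_neqE_nat nth_take)
  qed (use kn w len t m k in auto)
  moreover have "(drop (2 * k) vs, drop (2 * k) es) \<in> closed_walks (n - k)"
    unfolding closed_walks_iff
  proof (intro conjI)
    show "is_walk G (drop (2 * k) vs, drop (2 * k) es)"
      by (rule is_walk_drop[OF w(1)]) (use kn w(3) in simp)
    show "map c (drop (2 * k) es) = alternating_colors (n - k)"
      using alternating_colors_split(2)[of k n] kn by (simp add: w(2) flip: drop_map)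
    have "2 * k + 2 * (n - k) = 2 * n" using kn unfolding atLeastAtMost_iff by arith
    then show "drop (2 * k) vs ! (2 * (n - k)) = e" using w(5) len kn by simp
  qed (use kn w len m k in \<open>auto simp: diff_mult_distrib2\<close>)
  moreover have "w = concat_walk (take (Suc (2 * k)) vs, take (2 * k) es) (drop (2 * k) vs, drop (2 * k) es)"
    by (simp only: wdef concat_walk_take_drop)
  ultimately show "w \<in> ?R" using kn by force
qed

lemma finite_d_walks:
  assumes "multigraph G" "bounded_degrees G"
  shows "finite (d_walks n)"
  by (rule finite_subset[OF _ card_colored_walks(1)[OF assms, of c "alternating_colors n" e e]])
    (auto simp: d_walks_iff)

lemma card_closed_walks_renewal:
  assumes G: "multigraph G" "bounded_degrees G"
    and return: "\<And>vs es s t. is_walk G (vs, es) \<Longrightarrow> s < t \<Longrightarrow> t \<le> length es \<Longrightarrow> vs ! s = e \<Longrightarrow> vs ! t = e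
      \<Longrightarrow> (\<And>i. s < i \<Longrightarrow> i < t \<Longrightarrow> vs ! i \<noteq> e) \<Longrightarrow> c (es ! (t - 1)) = c (es ! s)"
    and n: "1 \<le> n"
  shows "card (closed_walks n) = (\<Sum>k=1..n. card (d_walks k) * card (closed_walks (n - k)))"
proof -
  let ?f = "\<lambda>(p, q). concat_walk p q"
  let ?P = "\<lambda>k. ?f ` (d_walks k \<times> closed_walks (n - k))"
  note dec = concat_d_walk_closed_walk(2)
  have "inj_on ?f (d_walks k \<times> closed_walks (n - k))" if "k \<in> {1..n}" for k
  proof (rule inj_onI)
    fix x y
    assume *: "x \<in> d_walks k \<times> closed_walks (n - k)" "y \<in> d_walks k \<times> closed_walks (n - k)"
      "?f x = ?f y"
    obtain p q p' q' where xy: "x = (p, q)" "y = (p', q')" by (cases x, cases y)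
    obtain vs es where "concat_walk p q = (vs, es)" by fastforce
    then show "x = y"
      using dec[of k n p q vs es] dec[of k n p' q' vs es] * that by (simp add: xy)
  qed
  then have card: "card (?P k) = card (d_walks k) * card (closed_walks (n - k))" if "k \<in> {1..n}" for k
    using that by (simp add: card_image card_cartesian_product)
  \<comment> \<open>A d-walk of length \<open>2 * k'\<close> visits \<open>e\<close> only once
    inside, but a prefix that is a d-walk of length \<open>2 * k\<close> produces two visits, at
    \<open>t\<close> and at \<open>2 * k\<close>.\<close>
  have once: "False"
    if kk: "k < k'" "k' \<le> n" and w: "(vs, es) \<in> ?P k" "(vs, es) \<in> ?P k'" and "1 \<le> k" for k k' vs es
  proof -
    obtain p q p' q' where pq: "p \<in> d_walks k" "q \<in> closed_walks (n - k)" "concat_walk p q = (vs, es)"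
      "p' \<in> d_walks k'" "q' \<in> closed_walks (n - k')" "concat_walk p' q' = (vs, es)"
      using w by auto
    have p: "(take (Suc (2 * k)) vs, take (2 * k) es) \<in> d_walks k"
      using dec[OF _ pq(1-3)] kk pq(1) by simp
    have p': "(take (Suc (2 * k')) vs, take (2 * k') es) \<in> d_walks k'"
      using dec[OF _ pq(4-6)] kk pq(4) by simp
    obtain t where t: "0 < t" "t < 2 * k" "take (Suc (2 * k)) vs ! t = e"
      using p unfolding d_walks_iff by blast
    obtain t' where t': "\<And>i. 0 < i \<Longrightarrow> i < 2 * k' \<Longrightarrow> i \<noteq> t' \<Longrightarrow> take (Suc (2 * k')) vs ! i \<noteq> e"
      using p' unfolding d_walks_iff by blast
    have "vs ! t = e" "vs ! (2 * k) = e"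
      using t p by (simp_all add: d_walks_iff closed_walks_iff)
    then show False
      using t'[of t] t'[of "2 * k"] t kk \<open>1 \<le> k\<close> by auto
  qed
  have disj: "?P k \<inter> ?P k' = {}" if "k \<in> {1..n}" "k' \<in> {1..n}" "k \<noteq> k'" for k k'
  proof (rule ccontr)
    assume "?P k \<inter> ?P k' \<noteq> {}"
    then obtain w where w: "w \<in> ?P k" "w \<in> ?P k'" by blast
    obtain vs es where "w = (vs, es)" by (cases w)
    with w have "(vs, es) \<in> ?P k" "(vs, es) \<in> ?P k'" by (simp_all only:)
    then show False
      using once[of k k' vs es] once[of k' k vs es] that by (cases k k' rule: linorder_cases) auto
  qed
  have "card (closed_walks n) = card (\<Union>k\<in>{1..n}. ?P k)"
    using closed_walks_renewal[OF return n] by (rule arg_cong)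
  also have "\<dots> = (\<Sum>k\<in>{1..n}. card (?P k))"
    by (rule card_UN_disjoint)
      (use disj finite_d_walks[OF G] card_colored_walks(1)[OF G] in auto)
  finally show ?thesis using card by simp
qed

end


section \<open>First returns in the free product\<close>

lemma attach_cases:
  assumes "x \<in> attach emb r w ` A"
  shows "x = w \<or> (\<exists>v. x = emb v # w)"
  using assms by (auto simp: attach_def)

text \<open>Each end of an edge is the base \<open>w\<close> of its copy or \<open>w\<close> with
  one letter of the edge's color in front. A nonempty \<open>w\<close> supplies the last letter of
  both ends; over the empty base the last letter is the added one.\<close>

lemma free_product_edge_last_color:
  assumes b: "b \<in> edges (free_product G1 G2)" and ends: "ends (free_product G1 G2) b = {x, y}"
    and y: "y \<noteq> []"
  shows "letter_color (last y) = (if x = [] then natural_color b else letter_color (last x))"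
proof -
  have "\<exists>w. \<forall>z\<in>{x, y}. z = w \<or> (\<exists>a. z = a # w \<and> letter_color a = natural_color b)"
  proof (cases "snd b")
    case (Inl \<beta>)
    then have "{x, y} = attach Inl (root_vertex G1) (fst b) ` ends G1 \<beta>" "natural_color b = Color1"
      using ends by (cases b; simp add: free_product_def)+
    then show ?thesis by (metis attach_cases letter_color.simps(1))
  next
    case (Inr \<beta>)
    then have "{x, y} = attach Inr (root_vertex G2) (fst b) ` ends G2 \<beta>" "natural_color b = Color2"
      using ends by (cases b; simp add: free_product_def)+
    then show ?thesis by (metis attach_cases letter_color.simps(2))
  qed
  then obtain w where w: "\<forall>z\<in>{x, y}. z = w \<or> (\<exists>a. z = a # w \<and> letter_color a = natural_color b)"
    by blast
  then show ?thesis using y by (cases "w = []") auto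
qed

text \<open>
  An excursion from the root stays in the branch entered by its first edge: the last letter of the
  visited words keeps the color of that edge, which is then also the color of the closing edge.
\<close>

lemma free_product_excursion_color:
  assumes walk: "is_walk (free_product G1 G2) (vs, es)" and st: "s < t" "t \<le> length es"
    and ends: "vs ! s = []" "vs ! t = []" and inner: "\<And>i. s < i \<Longrightarrow> i < t \<Longrightarrow> vs ! i \<noteq> []"
  shows "natural_color (es ! (t - 1)) = natural_color (es ! s)"
proof -
  let ?c = "natural_color (es ! s)"
  have edge: "es ! i \<in> edges (free_product G1 G2)"
    "ends (free_product G1 G2) (es ! i) = {vs ! i, vs ! Suc i}"
    if "i < length es" for i
    using walk that by auto
  have branch: "letter_color (last (vs ! i)) = ?c" if "Suc s \<le> i" "i < t" for i
    using that
  proof (induction i rule: nat_induct_at_least)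
    case base
    then show ?case
      using free_product_edge_last_color[OF edge[of s]] inner[of "Suc s"] ends(1) st by simp
  next
    case (Suc i)
    then show ?case
      using free_product_edge_last_color[OF edge[of i]] inner[of "Suc i"] inner[of i] st by simp
  qed
  show ?thesis
  \<comment> \<open>For \<open>t = Suc s\<close> the excursion is a single loop, and opening and
    closing edge coincide. Otherwise the closing edge is read backwards, from the root into the
    branch.\<close>
  proof (cases "t = Suc s")
    case False
    then obtain j where j: "t = Suc j" "s < j" using st(1) by (cases t) auto
    have "vs ! j \<noteq> []" using inner j by simp
    then have "letter_color (last (vs ! j)) = natural_color (es ! j)"
      using free_product_edge_last_color[of "es ! j" G1 G2 "vs ! Suc j" "vs ! j"] edge[of j] st ends(2) j
      by (simp add: insert_commute)
    then show ?thesis using branch[of j] j by simp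
  qed simp
qed


section \<open>The eta-series\<close>

text \<open>The renewal equation is the power series identity \<psi> = D (1 + \<psi>); dividing by 1
  + \<psi>, whose constant term is 1, leaves D.\<close>

lemma eta_coeff_renewal:
  assumes moments: "\<And>n. 1 \<le> n \<Longrightarrow> \<mu> (monom 1 n) = of_nat (m n)" and m0: "m 0 = 1"
    and renewal: "\<And>n. 1 \<le> n \<Longrightarrow> m n = (\<Sum>k=1..n. d k * m (n - k))" and n: "1 \<le> n"
  shows "eta_coeff \<mu> n = of_nat (d n)"
proof -
  let ?M = "Abs_fps (\<lambda>n. of_nat (m n)) :: complex fps"
  \<comment> \<open>The renewal sum starts at 1, so the constant term has to be 0 whatever
    \<open>d 0\<close> is.\<close>
  let ?D = "Abs_fps (\<lambda>n. if n = 0 then 0 else of_nat (d n)) :: complex fps"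
  have M: "1 + psi_series \<mu> = ?M"
    by (rule fps_ext) (auto simp: psi_series_def moments m0)
  have "psi_series \<mu> = ?D * ?M"
  proof (rule fps_ext)
    fix n
    show "fps_nth (psi_series \<mu>) n = fps_nth (?D * ?M) n"
    proof (cases "n = 0")
      case False
      then have "fps_nth (?D * ?M) n = (\<Sum>k=1..n. of_nat (d k) * of_nat (m (n - k)))"
        by (simp add: fps_mult_nth sum.atLeast_Suc_atMost)
      also have "\<dots> = of_nat (m n)" using renewal[of n] False by simp
      finally show ?thesis using False by (simp add: psi_series_def moments)
    qed (simp add: psi_series_def)
  qed
  moreover have "?M \<noteq> 0"
    using m0 by (auto simp: fps_eq_iff intro!: exI[of _ 0])
  ultimately have "eta_series \<mu> = ?D"
    unfolding eta_series_def M by simp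
  then show ?thesis using n by (simp add: eta_coeff_def)
qed


theorem theorem9p2:
  fixes G1 :: "('v, 'e) rgraph" and G2 :: "('w, 'd) rgraph"
    and G :: "(('v, 'w) word, ('v, 'w) word \<times> ('e + 'd)) rgraph"
    and \<mu>1 \<mu>2 :: functional
    and S1 S2 Z one :: "('v, 'w) word bop" and \<phi> :: "('v, 'w) word bop \<Rightarrow> complex"
  assumes "rooted_graph G1" and "rooted_graph G2"
    and "\<mu>1 = spectral_distribution G1" and "\<mu>2 = spectral_distribution G2"
    and "G = free_product G1 G2"
    and "S1 = adjacency (color_subgraph G natural_color Color1)"
    and "S2 = adjacency (color_subgraph G natural_color Color2)"
    and "Z = S2 * S1"
    and "\<phi> = vector_state (root_vertex G)"
    and "one = unit_op (verts G)"
  shows "(\<forall>n\<ge>1.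
            eta_coeff (distribution one \<phi> Z) n = eta_coeff (\<mu>1 \<boxtimes> \<mu>2) n \<and>
            finite (alternating_d_walks G natural_color (root_vertex G) (2 * n)) \<and>
            eta_coeff (\<mu>1 \<boxtimes> \<mu>2) n =
              of_nat (card (alternating_d_walks G natural_color (root_vertex G) (2 * n)))) \<and>
         free_pair one \<phi> (S1 - one) (S2 - one)"
proof -
  let ?V = "fp_verts G1 G2"
  let ?d = "\<lambda>n. alternating_d_walks G natural_color [] (2 * n)"
  let ?m = "\<lambda>n. card (colored_walks G natural_color (alternating_colors n) [] [])"
  have wf: "multigraph G" "bounded_degrees G"
    using assms(1,2,5) by (simp_all add: multigraph_free_product bounded_degrees_free_product)
  have V: "verts G = ?V" "root_vertex G = []"
    using assms(5) by (simp_all add: free_product_def)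
  have root: "[] \<in> ?V" by (simp add: fp_verts_def)
  \<comment> \<open>Only the trivial walk at the root has the empty color pattern.\<close>
  have m0: "?m 0 = 1"
    by (simp add: alternating_colors_def colored_walks_Nil V root)
  have renewal: "?m n = (\<Sum>k=1..n. card (?d k) * ?m (n - k))" if "1 \<le> n" for n
    by (rule card_closed_walks_renewal[OF wf _ that])
      (use assms(5) free_product_excursion_color in blast)
  have mom12: "distribution one \<phi> (S1 * S2) (monom 1 n) = of_nat (?m n)" for n
    using moment_alternating_product(1)[OF wf, of "[]" natural_color n] assms(6,7,9,10) V
    by (simp add: distribution_def poly_eval_monom)
  have mom21: "distribution one \<phi> Z (monom 1 n) = of_nat (?m n)" for n
    using moment_alternating_product(2)[OF wf, of "[]" natural_color n] assms(6-10) V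
    by (simp add: distribution_def poly_eval_monom)
  \<comment> \<open>The convolution is realized by \<open>S1 * S2\<close>, whereas \<open>Z\<close>
    has the opposite order; both have the moments \<open>?m n\<close>, and these determine the
    coefficients.\<close>
  have conv: "\<mu>1 \<boxtimes> \<mu>2 = distribution one \<phi> (S1 * S2)"
    using FP_mult_conv[OF assms(1,2)] assms(3-7,9,10) V by simp
  have "eta_coeff (distribution one \<phi> Z) n = of_nat (card (?d n))"
    and "eta_coeff (\<mu>1 \<boxtimes> \<mu>2) n = of_nat (card (?d n))" if "1 \<le> n" for n
    unfolding conv by (rule eta_coeff_renewal[where m = ?m, OF _ m0 renewal that]; simp add: mom12 mom21)+
  moreover have "finite (?d n)" for n by (rule finite_d_walks[OF wf])
  moreover have "free_pair one \<phi> (S1 - one) (S2 - one)"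
    using FP_free_shifted[OF assms(1,2)] assms(5-7,9,10) V by simp
  ultimately show ?thesis by (simp add: V)
qed

end
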